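(* Let $\vartheta:\{0,1\}\to\{0,1\}^+$ be a primitive constant length substitution, and assume that the substitution subshift $(X_\vartheta,\sigma)$ is infinite. Then $$\mathrm{ac}\big(\sigma|_{X_\vartheta}\big)=\frac{\log|\vartheta|}{\log|\vartheta|-\log|\vartheta|_\ast},$$ with $0<|\vartheta|_\ast\le|\vartheta|$ the number of positions $j\in\{0,\dots,|\vartheta|-1\}$ at which the words $\vartheta(0)$ and $\vartheta(1)$ differ (where the right-hand side is understood to be $\infty$ if $|\vartheta|_\ast=|\vartheta|$).
   Context: Let $A$ be a finite alphabet, $A^+$ the set of non-empty finite words over $A$, and $\Sigma=A^{\mathbb Z}$ with the product topology and the left shift $\sigma((x_n)_n)=(x_{n+1})_n$. A subshift is a pair $(X,\sigma)$ with $\emptyset\ne X\subseteq\Sigma$ closed and $\sigma(X)=X$; it is infinite if $X$ is an infinite set. It is minimal if $X$ has no non-empty proper closed subset $E$ with $\sigma(E)=E$. A substitution is a map $\vartheta:A\to A^+$, extended by concatenation to $A^+\to A^+$ and to $A^{\mathbb Z}\to A^{\mathbb Z}$ (with $\vartheta(x)=\dots\vartheta(x_{-1}).\vartheta(x_0)\vartheta(x_1)\dots$, the word $\vartheta(x_0)$ starting at coordinate $0$). It is primitive if for some $\ell>0$ and every $a\in A$ the word $\vartheta^\ell(a)$ contains every letter of $A$. It is of constant length $|\vartheta|=\ell$ if $\vartheta(a)\in A^\ell$ for all $a\in A$. For $\vartheta$ primitive, $X_\vartheta$ is the orbit closure $\overline{\{\sigma^k(x_0):k\in\mathbb Z\}}$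 of a point $x_0\in A^{\mathbb Z}$ with $\vartheta^p(x_0)=x_0$ for some $p\in\mathbb N$, chosen so that this orbit closure is minimal; such points exist and $X_\vartheta$ does not depend on the choice. Amorphic complexity: let $(X,\sigma)$ be a subshift and $d$ any metric inducing the product topology on $A^{\mathbb Z}$. For $\delta>0$ put $D_\delta(x,y)=\limsup_{n\to\infty}\frac1n\#\{0\le k\le n-1: d(\sigma^k(x),\sigma^k(y))\ge\delta\}$. For $\delta>0$, $\nu\in(0,1]$ let $\mathrm{Sep}(\sigma|_X,\delta,\nu)=\sup\{\#Y: Y\subseteq X,\ D_\delta(x,y)\ge\nu \text{ for all } x\ne y\text{ in }Y\}$. The lower and upper amorphic complexity are $\underline{\mathrm{ac}}(\sigma|_X)=\sup_{\delta>0}\liminf_{\nu\to0}\frac{\log\mathrm{Sep}(\sigma|_X,\delta,\nu)}{-\log\nu}$ and $\overline{\mathrm{ac}}(\sigma|_X)=\sup_{\delta>0}\limsup_{\nu\to0}\frac{\log\mathrm{Sep}(\sigma|_X,\delta,\nu)}{-\log\nu}$, with values in $[0,\infty]$; if they coincide, the common value is $\mathrm{ac}(\sigma|_X)$. (The assertion $\mathrm{ac}=c$ includes that they coincide.) *)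

theory Defs
  imports "HOL-Analysis.Analysis"
begin

section \<open>The full shift and its subshifts\<close>

text \<open>The alphabet is the universe of a finite type; bi-infinite words are functions on the integers.\<close>

definition full_shift_topology :: "(int \<Rightarrow> 'a) topology" where
  "full_shift_topology = product_topology (\<lambda>_. discrete_topology UNIV) UNIV"

definition shift :: "(int \<Rightarrow> 'a) \<Rightarrow> (int \<Rightarrow> 'a)" where
  "shift x = (\<lambda>n. x (n + 1))"

text \<open>The map \<open>\<lambda>n. x (n + k)\<close> is the \<open>k\<close>-th iterate of the (invertible) shift, for any integer \<open>k\<close>.\<close>

definition orbit_closure :: "(int \<Rightarrow> 'a) \<Rightarrow> (int \<Rightarrow> 'a) set" where
  "orbit_closure x = full_shift_topology closure_of range (\<lambda>k::int. \<lambda>n. x (n + k))"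

definition subshift :: "(int \<Rightarrow> 'a) set \<Rightarrow> bool" where
  "subshift X \<longleftrightarrow> X \<noteq> {} \<and> closedin full_shift_topology X \<and> shift ` X = X"

definition minimal_subshift :: "(int \<Rightarrow> 'a) set \<Rightarrow> bool" where
  "minimal_subshift X \<longleftrightarrow> subshift X \<and>
     (\<forall>E. E \<noteq> {} \<and> E \<subseteq> X \<and> closedin full_shift_topology E \<and> shift ` E = E \<longrightarrow> E = X)"

section \<open>Substitutions\<close>

definition substitution :: "('a \<Rightarrow> 'a list) \<Rightarrow> bool" where
  "substitution \<theta> \<longleftrightarrow> (\<forall>a. \<theta> a \<noteq> [])"

definition subst_word :: "('a \<Rightarrow> 'a list) \<Rightarrow> 'a list \<Rightarrow> 'a list" where
  "subst_word \<theta> w = concat (map \<theta> w)"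

definition primitive :: "('a \<Rightarrow> 'a list) \<Rightarrow> bool" where
  "primitive \<theta> \<longleftrightarrow> (\<exists>l>0. \<forall>a. set ((subst_word \<theta> ^^ l) [a]) = UNIV)"

definition constant_length :: "('a \<Rightarrow> 'a list) \<Rightarrow> nat \<Rightarrow> bool" where
  "constant_length \<theta> L \<longleftrightarrow> (\<forall>a. length (\<theta> a) = L)"

text \<open>The coordinate at which the block \<open>\<theta> (x n)\<close> starts in \<open>\<theta> x\<close>; it is \<open>0\<close> for \<open>n = 0\<close>, and
  for each \<open>n\<close> one of the two sums is empty.\<close>

definition block_start :: "('a \<Rightarrow> 'a list) \<Rightarrow> (int \<Rightarrow> 'a) \<Rightarrow> int \<Rightarrow> int" where
  "block_start \<theta> x n =
     (\<Sum>i\<in>{0..<n}. int (length (\<theta> (x i)))) - (\<Sum>i\<in>{n..<0}. int (length (\<theta> (x i))))"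

definition subst_biinf :: "('a \<Rightarrow> 'a list) \<Rightarrow> (int \<Rightarrow> 'a) \<Rightarrow> (int \<Rightarrow> 'a)" where
  "subst_biinf \<theta> x m =
     (let n = (THE n. block_start \<theta> x n \<le> m \<and> m < block_start \<theta> x (n + 1))
      in \<theta> (x n) ! nat (m - block_start \<theta> x n))"

lemma block_start_0: "block_start \<theta> x 0 = 0"
  by (simp add: block_start_def)

lemma block_start_step: "block_start \<theta> x (n + 1) = block_start \<theta> x n + int (length (\<theta> (x n)))"
proof (cases "n \<ge> 0")
  case True
  then have "{0..<n + 1} = insert n {0..<n}" by auto
  with True show ?thesis by (simp add: block_start_def)
next
  case False
  then have "{n..<0} = insert n {n + 1..<0}" by auto
  with False show ?thesis by (simp add: block_start_def)
qed

lemma block_start_mono: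
  assumes "substitution \<theta>" "m \<le> n"
  shows "block_start \<theta> x m + (n - m) \<le> block_start \<theta> x n"
  using assms(2)
proof (induction n rule: int_ge_induct)
  case base
  show ?case by simp
next
  case (step i)
  have "length (\<theta> (x i)) > 0"
    using assms(1) by (simp add: substitution_def)
  then have "int (length (\<theta> (x i))) \<ge> 1" by linarith
  with step block_start_step[of \<theta> x i] show ?case by linarith
qed

text \<open>The blocks of \<open>\<theta> x\<close> are the words \<open>\<theta> (x n)\<close>, in order.\<close>

lemma subst_biinf_block:
  assumes "substitution \<theta>" "j < length (\<theta> (x n))"
  shows "subst_biinf \<theta> x (block_start \<theta> x n + int j) = \<theta> (x n) ! j"
proof -
  let ?m = "block_start \<theta> x n + int j"
  have "(THE k. block_start \<theta> x k \<le> ?m \<and> ?m < block_start \<theta> x (k + 1)) = n"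
  proof (rule the_equality)
    show "block_start \<theta> x n \<le> ?m \<and> ?m < block_start \<theta> x (n + 1)"
      using assms(2) by (simp add: block_start_step)
    then have *: "block_start \<theta> x n \<le> ?m" "?m < block_start \<theta> x (n + 1)" by auto
    fix k
    assume k: "block_start \<theta> x k \<le> ?m \<and> ?m < block_start \<theta> x (k + 1)"
    have "\<not> k + 1 \<le> n"
      using block_start_mono[OF assms(1), of "k + 1" n x] k * by linarith
    moreover have "\<not> n + 1 \<le> k"
      using block_start_mono[OF assms(1), of "n + 1" k x] k * by linarith
    ultimately show "k = n" by linarith
  qed
  then show ?thesis by (simp add: subst_biinf_def)
qed

text \<open>\<open>X\<close> is the subshift of the primitive substitution \<open>\<theta>\<close>: the orbit closure of a
  \<open>\<theta>\<close>-periodic point with minimal orbit closure. For primitive \<open>\<theta>\<close> there is exactly one such \<open>X\<close>.\<close>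

definition is_substitution_subshift :: "('a \<Rightarrow> 'a list) \<Rightarrow> (int \<Rightarrow> 'a) set \<Rightarrow> bool" where
  "is_substitution_subshift \<theta> X \<longleftrightarrow>
     (\<exists>x0 p. p > 0 \<and> (subst_biinf \<theta> ^^ p) x0 = x0 \<and> X = orbit_closure x0 \<and> minimal_subshift X)"

section \<open>Amorphic complexity\<close>

definition compatible_metric :: "((int \<Rightarrow> 'a) \<Rightarrow> (int \<Rightarrow> 'a) \<Rightarrow> real) \<Rightarrow> bool" where
  "compatible_metric d \<longleftrightarrow>
     Metric_space UNIV d \<and> Metric_space.mtopology UNIV d = full_shift_topology"

definition sep_density ::
    "((int \<Rightarrow> 'a) \<Rightarrow> (int \<Rightarrow> 'a) \<Rightarrow> real) \<Rightarrow> real \<Rightarrow> (int \<Rightarrow> 'a) \<Rightarrow> (int \<Rightarrow> 'a) \<Rightarrow> ereal" where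
  "sep_density d \<delta> x y =
     limsup (\<lambda>n. ereal (real (card {k. k < n \<and> d ((shift ^^ k) x) ((shift ^^ k) y) \<ge> \<delta>}) / real n))"

definition separation_number ::
    "((int \<Rightarrow> 'a) \<Rightarrow> (int \<Rightarrow> 'a) \<Rightarrow> real) \<Rightarrow> (int \<Rightarrow> 'a) set \<Rightarrow> real \<Rightarrow> real \<Rightarrow> enat" where
  "separation_number d X \<delta> \<nu> =
     (SUP Y \<in> {Y. Y \<subseteq> X \<and> (\<forall>x\<in>Y. \<forall>y\<in>Y. x \<noteq> y \<longrightarrow> sep_density d \<delta> x y \<ge> ereal \<nu>)}.
        if finite Y then enat (card Y) else \<infinity>)"

text \<open>Only applied to separation numbers of non-empty sets, which are at least \<open>1\<close>.\<close>

definition ln_enat :: "enat \<Rightarrow> ereal" where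
  "ln_enat s = (case s of enat n \<Rightarrow> ereal (ln (real n)) | \<infinity> \<Rightarrow> \<infinity>)"

definition lower_amorphic_complexity ::
    "((int \<Rightarrow> 'a) \<Rightarrow> (int \<Rightarrow> 'a) \<Rightarrow> real) \<Rightarrow> (int \<Rightarrow> 'a) set \<Rightarrow> ereal" where
  "lower_amorphic_complexity d X =
     (SUP \<delta>\<in>{0<..}. Liminf (at_right 0) (\<lambda>\<nu>. ln_enat (separation_number d X \<delta> \<nu>) / ereal (- ln \<nu>)))"

definition upper_amorphic_complexity ::
    "((int \<Rightarrow> 'a) \<Rightarrow> (int \<Rightarrow> 'a) \<Rightarrow> real) \<Rightarrow> (int \<Rightarrow> 'a) set \<Rightarrow> ereal" where
  "upper_amorphic_complexity d X =
     (SUP \<delta>\<in>{0<..}. Limsup (at_right 0) (\<lambda>\<nu>. ln_enat (separation_number d X \<delta> \<nu>) / ereal (- ln \<nu>)))"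

definition has_amorphic_complexity ::
    "((int \<Rightarrow> 'a) \<Rightarrow> (int \<Rightarrow> 'a) \<Rightarrow> real) \<Rightarrow> (int \<Rightarrow> 'a) set \<Rightarrow> ereal \<Rightarrow> bool" where
  "has_amorphic_complexity d X c \<longleftrightarrow>
     lower_amorphic_complexity d X = c \<and> upper_amorphic_complexity d X = c"

section \<open>Binary substitutions of constant length\<close>

text \<open>The binary alphabet is the two-element numeral type \<open>2\<close>, whose elements are \<open>0\<close> and \<open>1\<close>.\<close>

definition mismatches :: "(2 \<Rightarrow> 2 list) \<Rightarrow> nat \<Rightarrow> nat" where
  "mismatches \<theta> L = card {j. j < L \<and> \<theta> 0 ! j \<noteq> \<theta> 1 ! j}"

end

theory Submission
  imports Defs
begin

text \<open>
  Let \<open>S\<close> be the power of the substitution that fixes the generating point \<open>x0\<close>, let \<open>Q\<close> be its length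
  and \<open>D\<close> the number of positions at which the two blocks \<open>S 0\<close> and \<open>S 1\<close> differ. Over two letters, mismatch
  numbers multiply under composition (\<open>block_mismatches_comp\<close>), so a \<open>p\<close>-th power has
  \<open>ln Q\<close> and \<open>ln D\<close> both multiplied by \<open>p\<close>, and the claimed quotient does not change. The reason for the formula is that
  for \<open>\<nu>\<close> of the order of \<open>(D / Q)^n\<close> the separation number is of the order of \<open>Q^n\<close>.

  Upper bound. Every point of \<open>X\<close> is a concatenation of the two blocks of the \<open>n\<close>-th power of \<open>S\<close>, cut at some
  residue class modulo \<open>Q^n\<close> (\<open>translated_blocks_cover\<close>). Two points with the same residue class
  mismatch with density at most \<open>(D / Q)^n\<close> (\<open>mismatch_count_block_subst_le\<close>). As a
  distance of at least \<open>\<delta>\<close> requires a mismatch in a window of bounded size, a \<open>\<nu>\<close>-separated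
  set has at most \<open>Q^n\<close> points once \<open>\<nu>\<close> exceeds a constant times \<open>(D / Q)^n\<close>.

  Lower bound. If \<open>X\<close> is infinite, no point can be cut into the two blocks of \<open>S\<close> in two ways
  (\<open>two_offsets_imp_periodic\<close>): by minimality a second way to cut would be available everywhere,
  and with two blocks only this forces periodicity. By compactness, points cut at different residue classes
  therefore mismatch with a density bounded below by a constant \<open>c\<close>
  (\<open>different_offsets_bounded_gaps\<close>). Applying \<open>S\<close> and its \<open>Q\<close> translates to a separated
  set multiplies the number of points by \<open>Q\<close> and the separating density by \<open>D / Q\<close>; iterating this
  yields \<open>Q^n\<close> points that mismatch pairwise with density at least \<open>c * (D / Q)^n\<close> (\<open>separated_sets\<close>).

  If \<open>D = Q\<close>, this density does not decrease, the separation numbers are infinite for small \<open>\<nu>\<close>, and so is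
  the complexity. Otherwise the two bounds give \<open>ln Q / (ln Q - ln D)\<close>.
\<close>


section \<open>Cylinders and compactness in the full shift\<close>

definition translate :: "int \<Rightarrow> (int \<Rightarrow> 'a) \<Rightarrow> int \<Rightarrow> 'a" where
  "translate k x = (\<lambda>n. x (n + k))"

text \<open>
  The sets of all \<open>y\<close> with \<open>agree N x y\<close> are the symmetric cylinders around \<open>x\<close>. They form a
  neighbourhood base, so every topological notion below is expressed through \<open>agree\<close>.
\<close>

definition agree :: "nat \<Rightarrow> (int \<Rightarrow> 'a) \<Rightarrow> (int \<Rightarrow> 'a) \<Rightarrow> bool" where
  "agree N x y \<longleftrightarrow> (\<forall>i. \<bar>i\<bar> \<le> int N \<longrightarrow> x i = y i)"

lemma agree_mono: "agree N x y \<Longrightarrow> M \<le> N \<Longrightarrow> agree M x y"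
  by (auto simp: agree_def)

lemma agree_refl: "agree N x x"
  by (simp add: agree_def)

lemma agree_trans: "agree N x y \<Longrightarrow> agree N y z \<Longrightarrow> agree N x z"
  by (auto simp: agree_def)

lemma translate_translate [simp]: "translate j (translate k x) = translate (j + k) x"
  by (simp add: translate_def fun_eq_iff algebra_simps)

lemma translate_0 [simp]: "translate 0 x = x"
  by (simp add: translate_def)

lemma shift_eq_translate: "shift x = translate 1 x"
  by (simp add: shift_def translate_def)

lemma funpow_shift: "(shift ^^ k) x = translate (int k) x"
  by (induction k) (simp_all add: shift_eq_translate)

lemma topspace_full_shift [simp]: "topspace full_shift_topology = UNIV"
  by (simp add: full_shift_topology_def)

lemma openin_full_shift_iff:
  "openin full_shift_topology U \<longleftrightarrow> (\<forall>x\<in>U. \<exists>N. \<forall>y. agree N x y \<longrightarrow> y \<in> U)" (is "_ = ?R")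
proof
  assume "openin full_shift_topology U"
  show ?R
  proof
    fix x assume "x \<in> U"
    then obtain V where V: "finite {i::int. V i \<noteq> (UNIV :: 'a set)}" "x \<in> Pi\<^sub>E UNIV V" "Pi\<^sub>E UNIV V \<subseteq> U"
      using \<open>openin full_shift_topology U\<close>
      unfolding full_shift_topology_def openin_product_topology_alt by fastforce
    define F where "F = {i::int. V i \<noteq> UNIV}"
    define N where "N = Max (insert 0 ((\<lambda>i. nat \<bar>i\<bar>) ` F))"
    have "finite F" using V by (simp add: F_def)
    then have le: "nat \<bar>i\<bar> \<le> N" if "i \<in> F" for i
      unfolding N_def using that by (intro Max_ge) auto
    have "y \<in> U" if "agree N x y" for y
    proof -
      have "y i \<in> V i" for i
      proof (cases "i \<in> F")
        case True
        then have "x i = y i" using le[OF True] that by (auto simp: agree_def)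
        then show ?thesis using V(2) by (auto simp: PiE_iff dest: spec[of _ i])
      qed (auto simp: F_def)
      then show ?thesis using V(3) by auto
    qed
    then show "\<exists>N. \<forall>y. agree N x y \<longrightarrow> y \<in> U" by blast
  qed
next
  assume R: ?R
  show "openin full_shift_topology U"
    unfolding full_shift_topology_def openin_product_topology_alt
  proof
    fix x assume "x \<in> U"
    then obtain N where N: "\<And>y. agree N x y \<Longrightarrow> y \<in> U" using R by blast
    define V where "V i = (if \<bar>i\<bar> \<le> int N then {x i} else UNIV)" for i
    have "{i. V i \<noteq> UNIV} \<subseteq> {- int N..int N}" by (auto simp: V_def split: if_splits)
    then have "finite {i. V i \<noteq> UNIV}" by (rule finite_subset) simp
    moreover have "x \<in> Pi\<^sub>E UNIV V" by (auto simp: V_def PiE_iff)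
    moreover have "Pi\<^sub>E UNIV V \<subseteq> U"
    proof
      fix y assume "y \<in> Pi\<^sub>E UNIV V"
      then have y: "y i \<in> V i" for i by auto
      have "agree N x y" unfolding agree_def
      proof (intro allI impI)
        fix i :: int assume "\<bar>i\<bar> \<le> int N"
        then show "x i = y i" using y[of i] by (simp add: V_def)
      qed
      then show "y \<in> U" by (rule N)
    qed
    ultimately show "\<exists>U'. finite {i \<in> UNIV. U' i \<noteq> topspace (discrete_topology UNIV)} \<and>
        (\<forall>i\<in>UNIV. openin (discrete_topology UNIV) (U' i)) \<and> x \<in> Pi\<^sub>E UNIV U' \<and> Pi\<^sub>E UNIV U' \<subseteq> U"
      by (intro exI[of _ V]) auto
  qed
qed

lemma openin_cylinder: "openin full_shift_topology {y. agree N x y}"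
  unfolding openin_full_shift_iff by (auto intro: agree_trans)

lemma closedin_full_shift_iff:
  "closedin full_shift_topology C \<longleftrightarrow> (\<forall>x. (\<forall>N. \<exists>y\<in>C. agree N x y) \<longrightarrow> x \<in> C)"
proof -
  have "closedin full_shift_topology C \<longleftrightarrow> (\<forall>x. x \<notin> C \<longrightarrow> (\<exists>N. \<forall>y. agree N x y \<longrightarrow> y \<notin> C))"
    by (auto simp: closedin_def openin_full_shift_iff)
  then show ?thesis by blast
qed

lemma continuous_map_full_shiftI:
  fixes f :: "(int \<Rightarrow> 'a) \<Rightarrow> (int \<Rightarrow> 'b)"
  assumes "\<And>N. \<exists>M. \<forall>x y. agree M x y \<longrightarrow> agree N (f x) (f y)"
  shows "continuous_map full_shift_topology full_shift_topology f"
  unfolding continuous_map_def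
proof (intro conjI allI impI)
  show "f \<in> topspace full_shift_topology \<rightarrow> topspace full_shift_topology" by auto
next
  fix U :: "(int \<Rightarrow> 'b) set" assume U: "openin full_shift_topology U"
  show "openin full_shift_topology {x \<in> topspace full_shift_topology. f x \<in> U}"
    unfolding openin_full_shift_iff
  proof
    fix x assume "x \<in> {x \<in> topspace full_shift_topology. f x \<in> U}"
    then obtain N where N: "\<And>y. agree N (f x) y \<Longrightarrow> y \<in> U"
      using U unfolding openin_full_shift_iff by blast
    obtain M where "\<forall>x y. agree M x y \<longrightarrow> agree N (f x) (f y)" using assms by blast
    with N show "\<exists>M. \<forall>y. agree M x y \<longrightarrow> y \<in> {x \<in> topspace full_shift_topology. f x \<in> U}"
      by auto
  qed
qed

lemma continuous_map_translate:
  "continuous_map full_shift_topology full_shift_topology (translate k)"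
proof (rule continuous_map_full_shiftI)
  fix N
  show "\<exists>M. \<forall>x y. agree M x y \<longrightarrow> agree N (translate k x) (translate k y)"
    by (intro exI[of _ "N + nat \<bar>k\<bar>"]) (auto simp: agree_def translate_def)
qed

lemma compact_space_full_shift: "compact_space (full_shift_topology :: (int \<Rightarrow> 'a::finite) topology)"
  by (simp add: full_shift_topology_def compact_space_product_topology compact_space_discrete_topology)

lemma closedin_imp_compactin_full_shift:
  "closedin full_shift_topology C \<Longrightarrow> compactin full_shift_topology (C :: (int \<Rightarrow> 'a::finite) set)"
  using closedin_compact_space compact_space_full_shift by blast

text \<open>
  A form of the Lebesgue number lemma: finitely many of the cylinders of radius \<open>r x\<close> around
  the points \<open>x\<close> of \<open>K\<close> already cover \<open>K\<close>. All uniform windows below come from here.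
\<close>

lemma compact_uniform_radius:
  assumes "compactin full_shift_topology K"
  shows "\<exists>N. \<forall>y\<in>K. \<exists>x\<in>K. r x \<le> N \<and> agree (r x) x y"
proof -
  have "\<exists>\<F>. finite \<F> \<and> \<F> \<subseteq> (\<lambda>x. {y. agree (r x) x y}) ` K \<and> K \<subseteq> \<Union>\<F>"
    by (rule compactinD[OF assms]) (auto intro: openin_cylinder agree_refl)
  then obtain F where F: "finite F" "F \<subseteq> K" "K \<subseteq> (\<Union>x\<in>F. {y. agree (r x) x y})"
    by (metis (no_types, lifting) finite_subset_image)
  define N where "N = Max (insert 0 (r ` F))"
  have le: "r x \<le> N" if "x \<in> F" for x
    unfolding N_def using that F(1) by (intro Max_ge) auto
  show ?thesis
    using F le by (intro exI[of _ N]) blast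
qed

lemma disjoint_compact_uniform_gap:
  assumes "compactin full_shift_topology K" "closedin full_shift_topology C" "K \<inter> C = {}"
  shows "\<exists>N. \<forall>x\<in>K. \<forall>y\<in>C. \<not> agree N x y"
proof -
  have "\<exists>N. \<forall>y\<in>C. \<not> agree N x y" if "x \<in> K" for x
    using assms(2,3) that unfolding closedin_full_shift_iff by blast
  then obtain r where r: "\<And>x y. x \<in> K \<Longrightarrow> y \<in> C \<Longrightarrow> \<not> agree (r x) x y" by metis
  obtain N where N: "\<And>y. y \<in> K \<Longrightarrow> \<exists>x\<in>K. r x \<le> N \<and> agree (r x) x y"
    using compact_uniform_radius[OF assms(1)] by metis
  show ?thesis
    by (intro exI[of _ N] ballI notI) (metis N r agree_mono agree_trans)
qed

text \<open>
  This and the next lemma are all that is used about the metric. They let the distance-based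
  separation densities be bounded, in both directions, by densities of mismatching letters.
\<close>

lemma compatible_metric_close_if_agree:
  fixes d :: "(int \<Rightarrow> 'a::finite) \<Rightarrow> _"
  assumes "compatible_metric d" "\<delta> > 0"
  shows "\<exists>N. \<forall>x y. agree N x y \<longrightarrow> d x y < \<delta>"
proof -
  interpret Metric_space UNIV d using assms(1) by (simp add: compatible_metric_def)
  have top: "mtopology = full_shift_topology" using assms(1) by (simp add: compatible_metric_def)
  have "\<exists>N. \<forall>y. agree N x y \<longrightarrow> d x y < \<delta> / 2" for x
  proof -
    have "openin full_shift_topology (mball x (\<delta>/2))" using openin_mball top by metis
    moreover have "x \<in> mball x (\<delta>/2)" using assms(2) by simp
    ultimately obtain N where "\<forall>y. agree N x y \<longrightarrow> y \<in> mball x (\<delta>/2)"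
      unfolding openin_full_shift_iff by blast
    then show ?thesis by auto
  qed
  then obtain r where r: "\<And>x y. agree (r x) x y \<Longrightarrow> d x y < \<delta> / 2" by metis
  have "compactin full_shift_topology (UNIV :: (int \<Rightarrow> 'a) set)"
    using compact_space_full_shift by (metis compact_space_def topspace_full_shift)
  then obtain N where N: "\<And>y. \<exists>x. r x \<le> N \<and> agree (r x) x y"
    using compact_uniform_radius[of UNIV r] by auto
  have "d y z < \<delta>" if yz: "agree N y z" for y z
  proof -
    obtain x where x: "r x \<le> N" "agree (r x) x y" using N by blast
    have "agree (r x) x z" using x yz agree_mono agree_trans by metis
    then have "d x y < \<delta>/2" "d x z < \<delta>/2" using r x by auto
    moreover have "d y z \<le> d y x + d x z" by (rule triangle) auto
    ultimately show ?thesis using commute[of x y] by simp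
  qed
  then show ?thesis by blast
qed

lemma compatible_metric_separates_letters:
  fixes d :: "(int \<Rightarrow> 'a::finite) \<Rightarrow> _"
  assumes "compatible_metric d"
  shows "\<exists>\<delta>>0. \<forall>x y. x 0 \<noteq> y 0 \<longrightarrow> d x y \<ge> \<delta>"
proof -
  interpret Metric_space UNIV d using assms(1) by (simp add: compatible_metric_def)
  have top: "mtopology = full_shift_topology" using assms(1) by (simp add: compatible_metric_def)
  have "\<exists>e>0. \<forall>y. d x y < e \<longrightarrow> x 0 = y 0" for x
  proof -
    have "openin mtopology {y. agree 0 x y}" using openin_cylinder top by metis
    then show ?thesis
      unfolding openin_mtopology using agree_refl[of 0 x]
      by (auto simp: agree_def subset_iff)
  qed
  then obtain e where e: "\<And>x. e x > 0" "\<And>x y. d x y < e x \<Longrightarrow> x 0 = y 0" by metis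
  have "compactin mtopology (UNIV :: (int \<Rightarrow> 'a) set)"
    unfolding top using compact_space_full_shift by (metis compact_space_def topspace_full_shift)
  then have "\<exists>\<F>. finite \<F> \<and> \<F> \<subseteq> range (\<lambda>x. mball x (e x / 2)) \<and> UNIV \<subseteq> \<Union>\<F>"
  proof (rule compactinD)
    fix U assume "U \<in> range (\<lambda>x. mball x (e x / 2))"
    then show "openin mtopology U" by (auto intro: openin_mball)
  next
    have "y \<in> mball y (e y / 2)" for y using e(1)[of y] by simp
    then show "UNIV \<subseteq> \<Union> (range (\<lambda>x. mball x (e x / 2)))" by blast
  qed
  then obtain F where F: "finite F" "UNIV \<subseteq> (\<Union>x\<in>F. mball x (e x / 2))"
    by (metis (no_types, lifting) finite_subset_image)
  define \<delta> where "\<delta> = Min (insert 1 ((\<lambda>x. e x / 2) ` F))"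
  have le: "\<delta> \<le> e x / 2" if "x \<in> F" for x
    unfolding \<delta>_def using that F(1) by (intro Min_le) auto
  have "\<delta> > 0" unfolding \<delta>_def using F(1) e(1) by (subst Min_gr_iff) auto
  moreover have "y 0 = z 0" if "d y z < \<delta>" for y z
  proof -
    obtain x where x: "x \<in> F" "d x y < e x / 2" using subsetD[OF F(2), of y] by auto
    have "d x z \<le> d x y + d y z" by (rule triangle) auto
    then have "d x z < e x" "d x y < e x" using x le[OF x(1)] that e(1)[of x] by linarith+
    then show ?thesis using e(2)[of x y] e(2)[of x z] by simp
  qed
  ultimately show ?thesis by (meson not_le)
qed


section \<open>Block substitutions\<close>

text \<open>
  Substitutions of constant length \<open>Q\<close>, with the letter at position \<open>j\<close> of the image of \<open>a\<close> given by
  \<open>h a j\<close>; only the positions \<open>0 \<le> j < Q\<close> matter. Functions instead of lists make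
  powers of a substitution a matter of \<open>div\<close> and \<open>mod\<close>.
\<close>

definition block_subst :: "int \<Rightarrow> ('a \<Rightarrow> int \<Rightarrow> 'a) \<Rightarrow> (int \<Rightarrow> 'a) \<Rightarrow> int \<Rightarrow> 'a" where
  "block_subst Q h x = (\<lambda>m. h (x (m div Q)) (m mod Q))"

lemma block_subst_translate:
  assumes "Q > 0"
  shows "block_subst Q h (translate k x) = translate (Q * k) (block_subst Q h x)"
  using assms by (simp add: block_subst_def translate_def fun_eq_iff add.commute)

lemma abs_div_le:
  fixes m Q :: int
  assumes "Q > 0"
  shows "\<bar>m div Q\<bar> \<le> \<bar>m\<bar>"
proof (cases "m \<ge> 0")
  case True
  have "m div Q \<ge> 0" using True assms by (simp add: pos_imp_zdiv_nonneg_iff)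
  moreover have "m div Q \<le> m div 1" using True assms by (intro zdiv_mono2) auto
  ultimately show ?thesis using True by simp
next
  case False
  have "m div Q < 0" using False assms by (simp add: pos_imp_zdiv_neg_iff)
  moreover have "m div 1 \<le> m div Q" using False assms by (intro zdiv_mono2_neg) auto
  ultimately show ?thesis using False by simp
qed

lemma continuous_map_block_subst:
  assumes "Q > 0"
  shows "continuous_map full_shift_topology full_shift_topology (block_subst Q h)"
proof (rule continuous_map_full_shiftI)
  fix N
  have "agree N (block_subst Q h x) (block_subst Q h y)" if "agree N x y" for x y
    using that abs_div_le[OF assms] unfolding agree_def block_subst_def
    by (metis order_trans)
  then show "\<exists>M. \<forall>x y. agree M x y \<longrightarrow> agree N (block_subst Q h x) (block_subst Q h y)" by blast
qed

lemma block_subst_comp: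
  assumes "Q > 0" "P > 0"
  shows "block_subst Q h (block_subst P g x) =
    block_subst (P * Q) (\<lambda>a j. h (g a (j div Q)) (j mod Q)) x"
proof
  fix m :: int
  have "m div (P * Q) = m div Q div P"
    using assms by (metis zdiv_zmult2_eq less_imp_le mult.commute)
  moreover have "m mod (P * Q) = Q * (m div Q mod P) + m mod Q"
    using assms by (metis zmod_zmult2_eq less_imp_le mult.commute)
  moreover have "(Q * (m div Q mod P) + m mod Q) div Q = m div Q mod P"
    using assms by (simp add: div_pos_pos_trivial)
  ultimately show "block_subst Q h (block_subst P g x) m =
    block_subst (P * Q) (\<lambda>a j. h (g a (j div Q)) (j mod Q)) x m"
    by (simp add: block_subst_def)
qed

lemma int_div_less:
  fixes j :: int
  assumes "j < P * Q" "0 < Q"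
  shows "j div Q < P"
proof (rule ccontr)
  assume "\<not> j div Q < P"
  then have "P * Q \<le> j div Q * Q" using assms(2) by (intro mult_right_mono) auto
  also have "\<dots> \<le> j" by (metis assms(2) div_mult_mod_eq le_add_same_cancel1 pos_mod_sign)
  finally show False using assms(1) by simp
qed

lemma two_cases: "(a :: 2) = 0 \<or> a = 1"
  using exhaust_2[of a] by auto

definition block_mismatches :: "int \<Rightarrow> (2 \<Rightarrow> int \<Rightarrow> 2) \<Rightarrow> nat" where
  "block_mismatches Q h = card {j\<in>{0..<Q}. h 0 j \<noteq> h 1 j}"

lemma block_mismatches_le: "Q \<ge> 0 \<Longrightarrow> block_mismatches Q h \<le> nat Q"
  unfolding block_mismatches_def
  by (rule order_trans[OF card_mono[of "{0..<Q}"]]) auto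

text \<open>
  Mismatch numbers multiply because the alphabet has two letters: two distinct letters are always
  the pair \<open>0\<close>, \<open>1\<close>, so every mismatch of the inner blocks produces exactly
  \<open>block_mismatches Q h\<close> mismatches, and every agreement produces none.
\<close>

lemma block_mismatches_comp:
  assumes "Q > 0" "P > 0"
  shows "block_mismatches (P * Q) (\<lambda>a j. h (g a (j div Q)) (j mod Q)) =
    block_mismatches P g * block_mismatches Q h"
proof -
  have iff: "h a j \<noteq> h b j \<longleftrightarrow> a \<noteq> b \<and> h 0 j \<noteq> h 1 j" for a b j
    using two_cases[of a] two_cases[of b] by auto
  let ?A = "{j\<in>{0..<P}. g 0 j \<noteq> g 1 j}" and ?B = "{j\<in>{0..<Q}. h 0 j \<noteq> h 1 j}"
  let ?C = "{j\<in>{0..<P * Q}. h (g 0 (j div Q)) (j mod Q) \<noteq> h (g 1 (j div Q)) (j mod Q)}"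
  have "bij_betw (\<lambda>j. (j div Q, j mod Q)) ?C (?A \<times> ?B)"
  proof (rule bij_betwI[where g = "\<lambda>(i, j). Q * i + j"])
    show "(\<lambda>j. (j div Q, j mod Q)) \<in> ?C \<rightarrow> ?A \<times> ?B"
    proof
      fix j assume j: "j \<in> ?C"
      then have "0 \<le> j div Q" using assms by (simp add: pos_imp_zdiv_nonneg_iff)
      moreover have "j div Q < P"
      proof -
        have "j \<in> {0..<P * Q}" using j by blast
        then have "j < P * Q" by simp
        then show ?thesis using assms(1) by (rule int_div_less)
      qed
      moreover have "g 0 (j div Q) \<noteq> g 1 (j div Q)" "h 0 (j mod Q) \<noteq> h 1 (j mod Q)"
        using j iff[of "g 0 (j div Q)" "j mod Q" "g 1 (j div Q)"] by blast+
      ultimately show "(j div Q, j mod Q) \<in> ?A \<times> ?B" using assms(1) by simp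
    qed
  next
    show "(\<lambda>(i, j). Q * i + j) \<in> ?A \<times> ?B \<rightarrow> ?C"
    proof (rule funcsetI, unfold split_paired_all, unfold case_prod_conv)
      fix i j assume "(i, j) \<in> ?A \<times> ?B"
      then have "i \<in> {0..<P}" "j \<in> {0..<Q}" and ne: "g 0 i \<noteq> g 1 i" "h 0 j \<noteq> h 1 j" by blast+
      then have ij: "0 \<le> i" "i < P" "0 \<le> j" "j < Q" by auto
      have "Q * (i + 1) \<le> Q * P" using ij assms by (intro mult_left_mono) auto
      then have "Q * i + j < P * Q" using ij by (simp add: distrib_left mult.commute)
      moreover have "0 \<le> Q * i + j" using ij assms by simp
      moreover have "(Q * i + j) div Q = i" "(Q * i + j) mod Q = j" using ij by auto
      moreover have "h (g 0 i) j \<noteq> h (g 1 i) j" using iff ne by blast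
      ultimately show "Q * i + j \<in> ?C" by simp
    qed
  next
    show "(case (j div Q, j mod Q) of (i, j) \<Rightarrow> Q * i + j) = j" for j by simp
  next
    show "((case x of (i, j) \<Rightarrow> Q * i + j) div Q, (case x of (i, j) \<Rightarrow> Q * i + j) mod Q) = x"
      if "x \<in> ?A \<times> ?B" for x using that by (auto simp: div_pos_pos_trivial)
  qed
  then have "card ?C = card (?A \<times> ?B)" by (rule bij_betw_same_card)
  also have "\<dots> = card ?A * card ?B" by (rule card_cartesian_product)
  finally show ?thesis unfolding block_mismatches_def .
qed

fun block_iterate :: "int \<Rightarrow> ('a \<Rightarrow> int \<Rightarrow> 'a) \<Rightarrow> nat \<Rightarrow> 'a \<Rightarrow> int \<Rightarrow> 'a" where
  "block_iterate Q h 0 = (\<lambda>a j. a)"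
| "block_iterate Q h (Suc n) = (\<lambda>a j. h (block_iterate Q h n a (j div Q)) (j mod Q))"

lemma funpow_block_subst:
  assumes "Q > 0"
  shows "(block_subst Q h ^^ n) x = block_subst (Q ^ n) (block_iterate Q h n) x"
proof (induction n)
  case 0
  then show ?case by (simp add: block_subst_def)
next
  case (Suc n)
  then show ?case using assms by (simp add: block_subst_comp mult.commute)
qed

lemma block_mismatches_iterate:
  assumes "Q > 0"
  shows "block_mismatches (Q ^ n) (block_iterate Q h n) = block_mismatches Q h ^ n"
proof (induction n)
  case 0
  have "{j::int. 0 \<le> j \<and> j < 1} = {0}" by auto
  then show ?case by (simp add: block_mismatches_def)
next
  case (Suc n)
  have "block_mismatches (Q ^ n * Q) (block_iterate Q h (Suc n)) = block_mismatches Q h ^ n * block_mismatches Q h"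
    using block_mismatches_comp[of Q "Q ^ n" h "block_iterate Q h n"] assms Suc by simp
  then show ?case by (simp add: mult.commute)
qed

section \<open>Counting mismatches of bi-infinite words\<close>

definition mismatch_count :: "(int \<Rightarrow> 'a) \<Rightarrow> (int \<Rightarrow> 'a) \<Rightarrow> int \<Rightarrow> int \<Rightarrow> nat" where
  "mismatch_count x y a b = card {j\<in>{a..<b}. x j \<noteq> y j}"

lemma finite_mismatch_positions: "finite {j\<in>{a..<b::int}. x j \<noteq> y j}"
  by (rule finite_subset[of _ "{a..<b}"]) auto

lemma mismatch_count_split: "a \<le> b \<Longrightarrow> b \<le> c \<Longrightarrow> mismatch_count x y a c = mismatch_count x y a b + mismatch_count x y b c"
  unfolding mismatch_count_def
  by (subst card_Un_disjoint[OF finite_mismatch_positions finite_mismatch_positions, symmetric])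
     (auto intro!: arg_cong[where f=card])

lemma mismatch_count_mono: "a' \<le> a \<Longrightarrow> b \<le> b' \<Longrightarrow> mismatch_count x y a b \<le> mismatch_count x y a' b'"
  unfolding mismatch_count_def by (rule card_mono[OF finite_mismatch_positions]) auto

lemma mismatch_count_le: "mismatch_count x y a b \<le> nat (b - a)"
  unfolding mismatch_count_def by (rule order_trans[OF card_mono[of "{a..<b}"]]) auto

lemma mismatch_count_translate: "mismatch_count (translate k x) (translate k y) a b = mismatch_count x y (a + k) (b + k)"
proof -
  have "bij_betw (\<lambda>j. j + k) {j\<in>{a..<b}. x (j + k) \<noteq> y (j + k)} {j\<in>{a + k..<b + k}. x j \<noteq> y j}"
    by (rule bij_betwI[where g = "\<lambda>j. j - k"]) auto
  then show ?thesis unfolding mismatch_count_def translate_def by (rule bij_betw_same_card)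
qed

lemma mismatch_count_one_block:
  assumes "Q > 0"
  shows "mismatch_count (block_subst Q h x) (block_subst Q h y) (Q * i) (Q * i + Q) =
    (if x i = y i then 0 else block_mismatches Q h)"
proof -
  have "mismatch_count (block_subst Q h x) (block_subst Q h y) (Q * i) (Q * i + Q) =
     mismatch_count (translate (Q * i) (block_subst Q h x)) (translate (Q * i) (block_subst Q h y)) 0 Q"
    by (simp add: mismatch_count_translate add.commute)
  also have "\<dots> = card {j\<in>{0..<Q}. h (x i) j \<noteq> h (y i) j}"
    unfolding mismatch_count_def
    using assms by (intro arg_cong[where f=card]) (auto simp: translate_def block_subst_def)
  also have "\<dots> = (if x i = y i then 0 else block_mismatches Q h)"
    using two_cases[of "x i"] two_cases[of "y i"]
    by (auto simp: block_mismatches_def intro!: arg_cong[where f=card])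
  finally show ?thesis .
qed

text \<open>
  The quantitative effect of a substitution: each mismatching letter is replaced by a pair of words
  with \<open>block_mismatches Q h\<close> mismatches, spread over \<open>Q\<close> positions. So the
  density of mismatches is multiplied by \<open>block_mismatches Q h / Q\<close>.
\<close>

lemma mismatch_count_blocks:
  assumes "Q > 0"
  shows "mismatch_count (block_subst Q h x) (block_subst Q h y) (Q * i) (Q * (i + int n)) =
    block_mismatches Q h * mismatch_count x y i (i + int n)"
proof (induction n)
  case 0
  then show ?case by (simp add: mismatch_count_def)
next
  case (Suc n)
  let ?k = "i + int n"
  have e: "Q * (i + int (Suc n)) = Q * ?k + Q" by (simp add: algebra_simps)
  have "{j\<in>{?k..<?k + 1}. x j \<noteq> y j} = (if x ?k = y ?k then {} else {?k})" by (auto split: if_splits)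
  then have m1: "mismatch_count x y ?k (?k + 1) = (if x ?k = y ?k then 0 else 1)" by (simp add: mismatch_count_def)
  have "mismatch_count (block_subst Q h x) (block_subst Q h y) (Q * i) (Q * ?k + Q) =
    block_mismatches Q h * mismatch_count x y i ?k + (if x ?k = y ?k then 0 else block_mismatches Q h)"
    using assms by (subst mismatch_count_split[of _ "Q * ?k"]) (auto simp: Suc mismatch_count_one_block)
  moreover have "mismatch_count x y i (?k + 1) = mismatch_count x y i ?k + mismatch_count x y ?k (?k + 1)"
    by (rule mismatch_count_split) auto
  ultimately show ?case unfolding e m1 by (simp add: algebra_simps)
qed

text \<open>
  Valid for arbitrary \<open>x\<close> and \<open>y\<close>: the interval meets at most \<open>(b - a) / Q + 2\<close>
  blocks, and even if all letters of \<open>x\<close> and \<open>y\<close> differ, each block contributes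
  \<open>block_mismatches Q h\<close> mismatches.
\<close>

lemma mismatch_count_block_subst_le:
  assumes "Q > 0" "a \<le> b"
  shows "real (mismatch_count (block_subst Q h x) (block_subst Q h y) a b) \<le>
    real (block_mismatches Q h) * (real_of_int (b - a) / real_of_int Q + 2)"
proof -
  let ?i = "a div Q" and ?n = "nat (b div Q + 1 - a div Q)"
  have le: "a div Q \<le> b div Q" using assms by (intro zdiv_mono1) auto
  then have n: "?i + int ?n = b div Q + 1" by simp
  have lo: "Q * ?i \<le> a" using assms(1) by (metis mult.commute mult_div_mod_eq pos_mod_sign add.commute le_add_same_cancel1)
  have "Q * (b div Q) + b mod Q = b" "b mod Q < Q" using assms(1) by simp_all
  then have "b \<le> Q * (b div Q) + Q" by linarith
  then have hi: "b \<le> Q * (?i + int ?n)" unfolding n by (simp only: distrib_left mult_1_right)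
  have "mismatch_count (block_subst Q h x) (block_subst Q h y) a b \<le> block_mismatches Q h * mismatch_count x y ?i (?i + int ?n)"
    using mismatch_count_mono[OF lo hi] mismatch_count_blocks[OF assms(1)] by metis
  also have "\<dots> \<le> block_mismatches Q h * ?n"
    using mismatch_count_le[of x y ?i "?i + int ?n"] by (intro mult_left_mono) auto
  finally have 1: "real (mismatch_count (block_subst Q h x) (block_subst Q h y) a b) \<le> real (block_mismatches Q h) * real ?n"
    by (metis of_nat_le_iff of_nat_mult)
  have "real_of_int (b div Q) \<le> real_of_int b / real_of_int Q"
    by (metis of_int_floor_le floor_divide_of_int_eq)
  moreover have "real_of_int (a div Q) \<ge> real_of_int a / real_of_int Q - 1"
    using real_of_int_floor_gt_diff_one[of "real_of_int a / real_of_int Q"]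
    unfolding floor_divide_of_int_eq by simp
  moreover have "real ?n = real_of_int (b div Q) + 1 - real_of_int (a div Q)" using le by simp
  ultimately have "real ?n \<le> real_of_int (b - a) / real_of_int Q + 2"
    by (simp add: diff_divide_distrib)
  then show ?thesis using 1 by (meson mult_left_mono of_nat_0_le_iff order_trans)
qed


section \<open>Subshifts generated by a fixed point\<close>

lemma orbit_closure_eq: "orbit_closure x = full_shift_topology closure_of range (\<lambda>k. translate k x)"
  by (simp add: orbit_closure_def translate_def)

lemma closedin_orbit_closure: "closedin full_shift_topology (orbit_closure x)"
  by (simp add: orbit_closure_eq)

lemma translate_in_orbit_closure: "translate k x \<in> orbit_closure x"
  unfolding orbit_closure_eq
  by (rule subsetD[OF closure_of_subset]) auto

lemma orbit_closure_subset:
  assumes "closedin full_shift_topology C" "\<And>k. translate k x \<in> C"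
  shows "orbit_closure x \<subseteq> C"
  unfolding orbit_closure_eq by (rule closure_of_minimal) (use assms in auto)

lemma closedin_full_shift_vimage:
  assumes "continuous_map full_shift_topology full_shift_topology f" "closedin full_shift_topology C"
  shows "closedin full_shift_topology {x. f x \<in> C}"
  using closedin_continuous_map_preimage[OF assms] by simp

lemma closedin_translate_image:
  fixes C :: "(int \<Rightarrow> 'a::finite) set"
  assumes "closedin full_shift_topology C"
  shows "closedin full_shift_topology (translate k ` C)"
proof -
  have "x \<in> translate k ` C" if "translate (- k) x \<in> C" for x
    using that by (rule rev_image_eqI) simp
  then have "translate k ` C = {x. translate (- k) x \<in> C}" by auto
  then show ?thesis
    using closedin_full_shift_vimage[OF continuous_map_translate assms] by simp
qed

lemma finite_orbit_closure_periodic: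
  fixes x :: "int \<Rightarrow> 'a::finite"
  assumes "P > 0" "translate P x = x"
  shows "finite (orbit_closure x)"
proof -
  have nat: "translate (int n * P) x = x" for n
  proof (induction n)
    case (Suc n)
    have "translate (int (Suc n) * P) x = translate P (translate (int n * P) x)"
      by (simp add: algebra_simps)
    then show ?case using Suc assms(2) by simp
  qed simp
  have per: "translate (i * P) x = x" for i
  proof (cases "i \<ge> 0")
    case True
    then show ?thesis using nat[of "nat i"] by simp
  next
    case False
    then have "translate (- i * P) x = x" using nat[of "nat (- i)"] by simp
    moreover have "translate (i * P) (translate (- i * P) x) = x" by simp
    ultimately show ?thesis by simp
  qed
  let ?C = "(\<lambda>k. translate k x) ` {0..<P}"
  have "translate k x \<in> ?C" for k
  proof -
    have "translate k x = translate (k mod P) (translate (k div P * P) x)"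
      by (simp add: add.commute)
    also have "\<dots> = translate (k mod P) x" by (simp only: per)
    finally show ?thesis using assms(1) by simp
  qed
  moreover have "closedin full_shift_topology {y}" for y :: "int \<Rightarrow> 'a"
  proof -
    have "x = y" if "\<forall>N. agree N x y" for x
    proof
      fix i show "x i = y i" using that[THEN spec, of "nat \<bar>i\<bar>"] by (simp add: agree_def)
    qed
    then show ?thesis unfolding closedin_full_shift_iff by blast
  qed
  then have "closedin full_shift_topology (\<Union>y\<in>?C. {y})"
    by (intro closedin_Union) auto
  then have "closedin full_shift_topology ?C" by simp
  ultimately have "orbit_closure x \<subseteq> ?C" by (intro orbit_closure_subset)
  then show ?thesis by (rule finite_subset) simp
qed

text \<open>
  A periodic point of a substitution is a fixed point of one of its powers, and that power has
  constant length again. The analysis is therefore carried out for fixed points.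
\<close>

locale block_fixed_point =
  fixes Q :: int and h :: "2 \<Rightarrow> int \<Rightarrow> 2" and x0 :: "int \<Rightarrow> 2" and X
  assumes Q_pos: "Q > 0"
    and fixed: "block_subst Q h x0 = x0"
    and X_eq: "X = orbit_closure x0"
    and minimal: "minimal_subshift X"
begin

abbreviation S where "S \<equiv> block_subst Q h"

lemma closed_X: "closedin full_shift_topology X"
  by (simp add: X_eq closedin_orbit_closure)

lemma x0_in_X: "x0 \<in> X"
  unfolding X_eq using translate_in_orbit_closure[of 0 x0] by simp

lemma translate_in_X: "x \<in> X \<Longrightarrow> translate k x \<in> X"
proof -
  have "X \<subseteq> {x. translate k x \<in> X}"
    unfolding X_eq
    by (rule orbit_closure_subset)
       (simp_all add: closedin_full_shift_vimage continuous_map_translate closedin_orbit_closure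
          translate_in_orbit_closure)
  then show "x \<in> X \<Longrightarrow> translate k x \<in> X" by blast
qed

lemma S_translate: "S (translate k x) = translate (Q * k) (S x)"
  by (rule block_subst_translate[OF Q_pos])

lemma S_in_X: "x \<in> X \<Longrightarrow> S x \<in> X"
proof -
  have "X \<subseteq> {x. S x \<in> X}"
    unfolding X_eq
    by (rule orbit_closure_subset)
       (simp_all add: closedin_full_shift_vimage continuous_map_block_subst[OF Q_pos]
          closedin_orbit_closure translate_in_orbit_closure S_translate fixed)
  then show "x \<in> X \<Longrightarrow> S x \<in> X" by blast
qed

lemma compact_SX: "compactin full_shift_topology (S ` X)"
  by (rule image_compactin[OF closedin_imp_compactin_full_shift[OF closed_X]
        continuous_map_block_subst[OF Q_pos]])

lemma closed_SX: "closedin full_shift_topology (S ` X)"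
proof -
  have "closedin full_shift_topology C" if "compactin full_shift_topology C" for C :: "(int \<Rightarrow> 2) set"
  proof -
    have "Hausdorff_space (full_shift_topology :: (int \<Rightarrow> 2) topology)"
      by (simp add: full_shift_topology_def Hausdorff_space_product_topology
          Hausdorff_space_discrete_topology)
    then show ?thesis using that by (rule compactin_imp_closedin)
  qed
  then show ?thesis using compact_SX by blast
qed

text \<open>
  The sets \<open>translate k ` S ` X\<close> for \<open>0 \<le> k < Q\<close> sort the points by where their
  blocks start. Their union is closed, and it contains the orbit of \<open>x0\<close> because
  \<open>S x0 = x0\<close>.
\<close>

lemma translated_blocks_cover: "x \<in> X \<Longrightarrow> \<exists>k\<in>{0..<Q}. \<exists>z\<in>X. x = translate k (S z)"
proof -
  let ?C = "\<Union>k\<in>{0..<Q}. translate k ` S ` X"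
  have "closedin full_shift_topology ?C"
    by (intro closedin_Union) (auto intro: closedin_translate_image closed_SX)
  moreover have "translate k x0 \<in> ?C" for k
  proof -
    have "translate k x0 = translate (k mod Q) (translate (Q * (k div Q)) x0)"
      by (simp add: add.commute)
    also have "\<dots> = translate (k mod Q) (S (translate (k div Q) x0))"
      by (simp add: S_translate fixed)
    finally have "translate k x0 \<in> translate (k mod Q) ` S ` X"
      using translate_in_X[OF x0_in_X, of "k div Q"] by blast
    moreover have "k mod Q \<in> {0..<Q}" using Q_pos by simp
    ultimately show ?thesis by blast
  qed
  ultimately have "X \<subseteq> ?C" unfolding X_eq[symmetric] by (metis X_eq orbit_closure_subset)
  then show "x \<in> X \<Longrightarrow> \<exists>k\<in>{0..<Q}. \<exists>z\<in>X. x = translate k (S z)" by blast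
qed

text \<open>
  \<open>S ` X\<close> is a factor of the minimal system \<open>X\<close>, with the \<open>Q\<close>-th power of the shift acting on it;
  hence it is minimal for that power, and two of its translates that meet must coincide. In
  terms of \<open>X\<close>: the points whose image can be cut into blocks with offset \<open>k\<close> as well form a closed
  invariant set, so if there is one such point, all points are of this kind.
\<close>

lemma offset_propagates:
  assumes "u \<in> X" "translate k (S u) \<in> S ` X" "z \<in> X"
  shows "translate k (S z) \<in> S ` X"
proof -
  let ?E = "{x \<in> X. translate k (S x) \<in> S ` X}"
  have step: "translate j x \<in> ?E" if "x \<in> ?E" for x j
  proof -
    have "translate k (S x) \<in> S ` X" using that by blast
    then obtain v where v: "v \<in> X" "translate k (S x) = S v" by (rule imageE)
    have "translate k (S (translate j x)) = translate (Q * j) (translate k (S x))"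
      by (simp add: S_translate add.commute)
    also have "\<dots> = S (translate j v)" by (simp add: v S_translate)
    finally show ?thesis using that v translate_in_X by blast
  qed
  have "closedin full_shift_topology ?E"
  proof (rule closedin_continuous_map_preimage_gen[OF _ closed_X closed_SX])
    show "continuous_map full_shift_topology full_shift_topology (\<lambda>x. translate k (S x))"
      using continuous_map_compose[OF continuous_map_block_subst[OF Q_pos, of h] continuous_map_translate[of k]]
      by (simp add: comp_def)
  qed
  moreover have "shift ` ?E = ?E"
  proof
    show "shift ` ?E \<subseteq> ?E" using step[of _ 1] by (auto simp: shift_eq_translate)
    show "?E \<subseteq> shift ` ?E"
    proof
      fix x assume "x \<in> ?E"
      then have "translate (- 1) x \<in> ?E" by (rule step)
      moreover have "x = shift (translate (- 1) x)" by (simp add: shift_eq_translate)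
      ultimately show "x \<in> shift ` ?E" using image_eqI[of x shift "translate (- 1) x" ?E] by blast
    qed
  qed
  moreover have "?E \<noteq> {}" "?E \<subseteq> X" using assms by auto
  moreover have "E = X" if "closedin full_shift_topology E" "shift ` E = E" "E \<noteq> {}" "E \<subseteq> X" for E
    using minimal that unfolding minimal_subshift_def by blast
  ultimately have "?E = X" by meson
  then show ?thesis using assms(3) by blast
qed

text \<open>
  The admissible offsets form a subgroup of the integers that contains \<open>Q\<close>.
\<close>

lemma offset_group:
  assumes k: "\<And>z. z \<in> X \<Longrightarrow> translate k (S z) \<in> S ` X" and "z \<in> X"
  shows "translate (i * k + j * Q) (S z) \<in> S ` X"
proof -
  have nat: "translate (int n * k) (S z) \<in> S ` X" if "z \<in> X" for n z
  proof (induction n)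
    case 0
    then show ?case using that by simp
  next
    case (Suc n)
    then obtain w where "w \<in> X" "translate (int n * k) (S z) = S w" by blast
    moreover have "translate (int (Suc n) * k) (S z) = translate k (translate (int n * k) (S z))"
      by (simp add: algebra_simps)
    ultimately show ?case using k by simp
  qed
  \<comment> \<open>\<open>i + \<bar>i\<bar> * Q \<ge> 0\<close>, so negative multiples reduce to non-negative ones modulo \<open>Q\<close>.\<close>
  define n where "n = nat (i + \<bar>i\<bar> * Q)"
  have "\<bar>i\<bar> * 1 \<le> \<bar>i\<bar> * Q" using Q_pos by (intro mult_left_mono) auto
  then have "int n = i + \<bar>i\<bar> * Q" by (simp add: n_def)
  then have "i * k + j * Q = int n * k + Q * (j - \<bar>i\<bar> * k)" by (simp add: algebra_simps)
  then have "translate (i * k + j * Q) (S z) = translate (int n * k) (S (translate (j - \<bar>i\<bar> * k) z))"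
    by (simp add: S_translate)
  then show ?thesis using nat translate_in_X assms(2) by metis
qed

text \<open>
  The heart of the lower bound, an elementary recognizability result. If blocks can be read at a
  second offset \<open>r\<close>, they can be read at all multiples of \<open>g = gcd r Q\<close>, and \<open>2 * g \<le> Q\<close>. So \<open>x0\<close> is a
  sequence of words of length \<open>g\<close> in which two consecutive words always form a prefix of one
  of only two blocks. If the two blocks have the same prefix of length \<open>g\<close>, then \<open>x0\<close>
  has period \<open>g\<close>. Otherwise each word determines its successor, and a bi-infinite sequence over two
  symbols with this property has period at most \<open>2\<close>. In both cases \<open>2 * g\<close> is a period.
\<close>

lemma two_offsets_imp_periodic:
  assumes r: "0 < r" "r < Q" and u: "u \<in> X" "translate r (S u) \<in> S ` X"
  shows "\<exists>P>0. translate P x0 = x0"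
proof -
  define g where "g = gcd r Q"
  have g: "0 < g" "g dvd Q" using r by (simp_all add: g_def)
  have "g \<le> r" unfolding g_def using r by (simp add: zdvd_imp_le)
  \<comment> \<open>since \<open>g \<le> r < Q\<close>, the divisor \<open>g\<close> of \<open>Q\<close> is proper, hence at most half of \<open>Q\<close>\<close>
  obtain q where q: "Q = g * q" using g(2) by blast
  have "q \<noteq> 1" using q \<open>g \<le> r\<close> r by auto
  moreover have "q > 0" using q Q_pos g(1) by (simp add: zero_less_mult_iff)
  ultimately have "g * 2 \<le> g * q" using g by (intro mult_left_mono) auto
  then have g2: "2 * g \<le> Q" using q by simp
  obtain a b where ab: "g = a * r + b * Q" unfolding g_def by (metis bezout_int)
  have "translate (i * g) x0 \<in> S ` X" for i
  proof -
    have "i * g = (i * a) * r + (i * b) * Q" by (simp add: ab algebra_simps)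
    then have "translate (i * g) (S x0) \<in> S ` X"
      using offset_group[OF offset_propagates[OF u] x0_in_X, of "i * a" "i * b"] by simp
    then show ?thesis by (simp add: fixed)
  qed
  then have "\<exists>v. translate (i * g) x0 = S v" for i by blast
  then obtain v where v: "\<And>i. translate (i * g) x0 = S (v i)" by metis
  define e where "e i = v i 0" for i
  \<comment> \<open>the word of length \<open>Q\<close> of \<open>x0\<close> at \<open>i * g\<close> is one of the two blocks, with letter \<open>e i\<close>\<close>
  have block: "x0 (i * g + j) = h (e i) j" if "0 \<le> j" "j < Q" for i j
  proof -
    have "x0 (i * g + j) = translate (i * g) x0 j" by (simp add: translate_def add.commute)
    also have "\<dots> = h (e i) j" unfolding v e_def using that by (simp add: block_subst_def)
    finally show ?thesis .
  qed
  have next_block: "h (e (i + 1)) j = h (e i) (g + j)" if "0 \<le> j" "j < g" for i j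
    using block[of j "i + 1"] block[of "g + j" i] that g2 g(1) by (simp add: algebra_simps)
  have two: "h (e (i + 2)) j = h (e i) j" if j: "0 \<le> j" "j < g" for i j
  proof (cases "\<forall>j. 0 \<le> j \<and> j < g \<longrightarrow> h 0 j = h 1 j")
    case True
    then show ?thesis using j two_cases[of "e (i + 2)"] two_cases[of "e i"] by auto
  next
    case False
    then have inj: "a = b" if "\<forall>j. 0 \<le> j \<and> j < g \<longrightarrow> h a j = h b j" for a b
      using that two_cases[of a] two_cases[of b] by metis
    have det: "e (k + 1) = e (l + 1)" if "e k = e l" for k l
    proof (rule inj, intro allI impI)
      fix j assume "0 \<le> j \<and> j < g"
      then show "h (e (k + 1)) j = h (e (l + 1)) j" using next_block[of j k] next_block[of j l] that by simp
    qed
    have "e (i + 2) = e i"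
    proof (rule ccontr)
      assume ne: "e (i + 2) \<noteq> e i"
      have i2: "i + 1 + 1 = i + 2" by simp
      have "e (i + 1) = e i \<Longrightarrow> e (i + 2) = e (i + 1)" using det[of "i + 1" i, unfolded i2] .
      then have "e (i + 1) \<noteq> e i" using ne by metis
      then have e12: "e (i + 1) = e (i + 2)" using ne
        using two_cases[of "e i"] two_cases[of "e (i + 1)"] two_cases[of "e (i + 2)"] by metis
      \<comment> \<open>going back to \<open>i - 1\<close> rules out that the sequence becomes periodic only after position \<open>i\<close>\<close>
      have "e (i - 1) = e i \<or> e (i - 1) = e (i + 1)"
        using \<open>e (i + 1) \<noteq> e i\<close> two_cases[of "e i"] two_cases[of "e (i + 1)"] two_cases[of "e (i - 1)"] by metis
      then show False
        using det[of "i - 1" i] det[of "i - 1" "i + 1"] e12 \<open>e (i + 1) \<noteq> e i\<close> by (auto simp: algebra_simps)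
    qed
    then show ?thesis by simp
  qed
  have "x0 (m + 2 * g) = x0 m" for m
  proof -
    have "m div g * g + m mod g = m" by simp
    then have m: "m + 2 * g = (m div g + 2) * g + m mod g" unfolding distrib_right by linarith
    have mod: "0 \<le> m mod g" "m mod g < g" using g(1) by simp_all
    then have j: "0 \<le> m mod g" "m mod g < g" "m mod g < Q" using g(1) g2 by linarith+
    have "x0 (m + 2 * g) = x0 ((m div g + 2) * g + m mod g)"
      by (simp only: m)
    also have "\<dots> = h (e (m div g)) (m mod g)" using block[OF j(1,3)] two[OF j(1,2)] by simp
    also have "\<dots> = x0 m" using block[OF j(1,3), of "m div g"] by simp
    finally show ?thesis .
  qed
  then have "translate (2 * g) x0 = x0" by (simp add: translate_def)
  then show ?thesis using g(1) by (intro exI[of _ "2 * g"]) simp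
qed

lemma block_offsets_unique:
  assumes "infinite X" "0 < r" "r < Q" "u \<in> X" "v \<in> X"
  shows "translate r (S u) \<noteq> S v"
proof
  assume "translate r (S u) = S v"
  then have "translate r (S u) \<in> S ` X" using assms(5) by simp
  then obtain P where "P > 0" "translate P x0 = x0"
    using two_offsets_imp_periodic assms by blast
  then show False using finite_orbit_closure_periodic assms(1) X_eq by blast
qed

text \<open>
  If the two blocks coincide, then \<open>x0 = S x0\<close> repeats one and the same block, so \<open>X\<close> is finite.
\<close>

lemma mismatches_pos:
  assumes "infinite X"
  shows "block_mismatches Q h > 0"
proof (rule ccontr)
  assume "\<not> ?thesis"
  moreover have "finite {j\<in>{0..<Q}. h 0 j \<noteq> h 1 j}" by (rule finite_mismatch_positions)
  ultimately have "{j\<in>{0..<Q}. h 0 j \<noteq> h 1 j} = {}" unfolding block_mismatches_def by (metis card_gt_0_iff)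
  then have h: "h a j = h b j" if "0 \<le> j" "j < Q" for a b j
    using that two_cases[of a] two_cases[of b] by auto
  have "x0 (m + Q) = x0 m" for m
  proof -
    have "x0 (m + Q) = S x0 (m + Q)" "x0 m = S x0 m" by (simp_all add: fixed)
    moreover have "S x0 (m + Q) = S x0 m"
      unfolding block_subst_def using Q_pos h[of "m mod Q"] by simp
    ultimately show ?thesis by simp
  qed
  then have "translate Q x0 = x0" by (simp add: translate_def)
  then show False using finite_orbit_closure_periodic[OF Q_pos] assms X_eq by blast
qed

end


section \<open>Lower density of mismatches\<close>

text \<open>
  The mismatches have lower density at least \<open>c\<close>, with a bounded error term. This
  is stronger than a bound on a limit superior and is preserved by translations and substitutions
  through counting alone, without any limit.
\<close>

definition mismatch_density_ge :: "real \<Rightarrow> (int \<Rightarrow> 'a) \<Rightarrow> (int \<Rightarrow> 'a) \<Rightarrow> bool" where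
  "mismatch_density_ge c x y \<longleftrightarrow> (\<exists>K. \<forall>n::nat. c * real n - K \<le> real (mismatch_count x y 0 (int n)))"

lemma mismatch_density_ge_mono: "mismatch_density_ge c x y \<Longrightarrow> c' \<le> c \<Longrightarrow> mismatch_density_ge c' x y"
  unfolding mismatch_density_ge_def by (meson diff_right_mono mult_right_mono of_nat_0_le_iff order_trans)

lemma not_mismatch_density_ge_refl:
  assumes "c > 0"
  shows "\<not> mismatch_density_ge c x x"
proof
  assume "mismatch_density_ge c x x"
  then obtain K where K: "\<And>n::nat. c * real n - K \<le> 0" unfolding mismatch_density_ge_def mismatch_count_def by auto
  obtain n :: nat where "real n > K / c" using reals_Archimedean2 by blast
  then have "c * real n > K" using assms by (simp add: field_simps)
  then show False using K[of n] by simp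
qed

lemma mismatch_density_ge_translate:
  assumes "mismatch_density_ge c x y" "k \<ge> 0"
  shows "mismatch_density_ge c (translate k x) (translate k y)"
proof -
  obtain K where K: "\<And>n::nat. c * real n - K \<le> real (mismatch_count x y 0 (int n))"
    using assms unfolding mismatch_density_ge_def by blast
  have "c * real n - (K + real (nat k)) \<le> real (mismatch_count (translate k x) (translate k y) 0 (int n))" for n
  proof -
    have "mismatch_count x y 0 (int n) \<le> mismatch_count x y 0 (int n + k)" using assms(2) by (intro mismatch_count_mono) auto
    also have "\<dots> = mismatch_count x y 0 k + mismatch_count x y k (int n + k)" using assms(2) by (intro mismatch_count_split) auto
    also have "\<dots> \<le> nat k + mismatch_count (translate k x) (translate k y) 0 (int n)"
      using mismatch_count_le[of x y 0 k] by (simp add: mismatch_count_translate)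
    finally have "real (mismatch_count x y 0 (int n)) \<le> real (nat k) + real (mismatch_count (translate k x) (translate k y) 0 (int n))"
      by linarith
    then show ?thesis using K[of n] by linarith
  qed
  then show ?thesis unfolding mismatch_density_ge_def by blast
qed

lemma real_div_minus_one_le: 
  assumes "W > 0"
  shows "real n / real W - 1 \<le> real (n div W)"
proof -
  have "n div W * W + n mod W = n" "n mod W < W" using assms by simp_all
  then have "n < (n div W + 1) * W" unfolding distrib_right by linarith
  then have "real n < real ((n div W + 1) * W)" by (simp only: of_nat_less_iff)
  then show ?thesis using assms by (simp add: field_simps)
qed

lemma mismatch_density_ge_block_subst:
  assumes "mismatch_density_ge c x y" "Q > 0" "c \<ge> 0"
  shows "mismatch_density_ge (c * (real (block_mismatches Q h) / real_of_int Q)) (block_subst Q h x) (block_subst Q h y)"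
proof -
  let ?D = "block_mismatches Q h"
  obtain K where K: "\<And>n::nat. c * real n - K \<le> real (mismatch_count x y 0 (int n))"
    using assms unfolding mismatch_density_ge_def by blast
  have "c * (real ?D / real_of_int Q) * real n - real ?D * (c + K)
      \<le> real (mismatch_count (block_subst Q h x) (block_subst Q h y) 0 (int n))" for n
  proof -
    let ?m = "n div nat Q"
    have "real n / real (nat Q) - 1 \<le> real ?m" using assms(2) by (intro real_div_minus_one_le) simp
    then have "c * (real n / real_of_int Q - 1) \<le> c * real ?m"
      using assms(2,3) by (intro mult_left_mono) auto
    then have "c * (real n / real_of_int Q - 1) - K \<le> real (mismatch_count x y 0 (int ?m))"
      using K[of ?m] by linarith
    then have "real ?D * (c * (real n / real_of_int Q - 1) - K) \<le> real ?D * real (mismatch_count x y 0 (int ?m))"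
      by (intro mult_left_mono) auto
    also have "\<dots> = real (mismatch_count (block_subst Q h x) (block_subst Q h y) 0 (Q * int ?m))"
      using mismatch_count_blocks[OF assms(2), of h x y 0 ?m] by simp
    also have "\<dots> \<le> real (mismatch_count (block_subst Q h x) (block_subst Q h y) 0 (int n))"
    proof -
      have "Q * int ?m = int (nat Q * ?m)" using assms(2) by simp
      also have "\<dots> \<le> int n" by (simp only: of_nat_le_iff times_div_less_eq_dividend)
      finally show ?thesis by (intro of_nat_mono mismatch_count_mono) auto
    qed
    finally show ?thesis by (simp add: algebra_simps)
  qed
  then show ?thesis unfolding mismatch_density_ge_def by blast
qed

lemma mismatch_density_ge_if_bounded_gaps:
  assumes "W > 0" "\<And>a. \<exists>j\<in>{a..<a + int W}. x j \<noteq> y j"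
  shows "mismatch_density_ge (1 / real W) x y"
proof -
  have one: "mismatch_count x y a (a + int W) \<ge> 1" for a
  proof -
    have "{j \<in> {a..<a + int W}. x j \<noteq> y j} \<noteq> {}" using assms(2)[of a] by blast
    then show ?thesis unfolding mismatch_count_def using finite_mismatch_positions[of a "a + int W" x y]
      by (simp add: Suc_le_eq card_gt_0_iff)
  qed
  have multi: "q \<le> mismatch_count x y 0 (int (W * q))" for q
  proof (induction q)
    case (Suc q)
    have "mismatch_count x y 0 (int (W * Suc q)) =
        mismatch_count x y 0 (int (W * q)) + mismatch_count x y (int (W * q)) (int (W * q) + int W)"
      by (subst mismatch_count_split[of 0 "int (W * q)"]) (simp_all add: algebra_simps)
    then show ?case using Suc one[of "int (W * q)"] by linarith
  qed simp
  have "1 / real W * real n - 1 \<le> real (mismatch_count x y 0 (int n))" for n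
  proof -
    have "n div W \<le> mismatch_count x y 0 (int (W * (n div W)))" by (rule multi)
    also have "\<dots> \<le> mismatch_count x y 0 (int n)"
      by (intro mismatch_count_mono) (simp_all only: of_nat_le_iff times_div_less_eq_dividend order_refl)
    finally show ?thesis using real_div_minus_one_le[OF assms(1), of n] by simp
  qed
  then show ?thesis unfolding mismatch_density_ge_def by blast
qed

lemma sep_density_ge:
  assumes "mismatch_density_ge c x y" and \<delta>: "\<And>x y. x 0 \<noteq> y 0 \<Longrightarrow> d x y \<ge> \<delta>"
  shows "ereal c \<le> sep_density d \<delta> x y"
proof -
  obtain K where K: "\<And>n::nat. c * real n - K \<le> real (mismatch_count x y 0 (int n))"
    using assms unfolding mismatch_density_ge_def by blast
  let ?A = "\<lambda>n. {k. k < n \<and> d ((shift ^^ k) x) ((shift ^^ k) y) \<ge> \<delta>}"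
  have "mismatch_count x y 0 (int n) \<le> card (?A n)" for n
  proof -
    have "{j\<in>{0..<int n}. x j \<noteq> y j} \<subseteq> int ` ?A n"
    proof
      fix j assume j: "j \<in> {j\<in>{0..<int n}. x j \<noteq> y j}"
      then have "nat j \<in> ?A n" by (auto intro!: \<delta> simp: funpow_shift translate_def)
      then show "j \<in> int ` ?A n" using j by (intro rev_image_eqI) auto
    qed
    then have "mismatch_count x y 0 (int n) \<le> card (int ` ?A n)" unfolding mismatch_count_def by (intro card_mono) auto
    also have "\<dots> \<le> card (?A n)" by (intro card_image_le) auto
    finally show ?thesis .
  qed
  then have le: "c * real n - K \<le> real (card (?A n))" for n
    using K[of n] by (meson of_nat_le_iff order_trans)
  have "(\<lambda>n. c - K / real n) \<longlonglongrightarrow> c - 0"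
    by (rule tendsto_diff[OF tendsto_const lim_const_over_n])
  then have "(\<lambda>n. ereal (c - K / real n)) \<longlonglongrightarrow> ereal c" by simp
  then have "ereal c = limsup (\<lambda>n. ereal (c - K / real n))"
    by (intro lim_imp_Limsup[symmetric]) auto
  also have "\<dots> \<le> sep_density d \<delta> x y"
    unfolding sep_density_def
  proof (rule Limsup_mono)
    show "\<forall>\<^sub>F n in sequentially. ereal (c - K / real n) \<le> ereal (real (card (?A n)) / real n)"
      using eventually_gt_at_top[of 0]
    proof eventually_elim
      case (elim n)
      have "(c * real n - K) / real n \<le> real (card (?A n)) / real n"
        using le[of n] by (intro divide_right_mono) auto
      then show ?case using elim by (simp add: diff_divide_distrib)
    qed
  qed
  finally show ?thesis .
qed

text \<open>
  A distance of at least \<open>\<delta>\<close> at time \<open>k\<close> needs a mismatch within distance \<open>N\<close> of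
  position \<open>k\<close>, and each mismatch serves at most \<open>2 * N + 1\<close> times \<open>k\<close>.
\<close>

lemma sep_density_le:
  assumes N: "\<And>x y. agree N x y \<Longrightarrow> d x y < \<delta>"
    and M: "\<And>n. real (mismatch_count x y (- int N) (int n + int N)) \<le> A * real n + B"
  shows "sep_density d \<delta> x y \<le> ereal (real (2 * N + 1) * A)"
proof -
  let ?A = "\<lambda>n. {k. k < n \<and> d ((shift ^^ k) x) ((shift ^^ k) y) \<ge> \<delta>}"
  let ?N = "real (2 * N + 1)"
  have le: "real (card (?A n)) \<le> ?N * (A * real n + B)" for n
  proof -
    let ?U = "\<lambda>i. {k. k < n \<and> x (int k + i) \<noteq> y (int k + i)}"
    have "?A n \<subseteq> (\<Union>i\<in>{- int N..int N}. ?U i)"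
    proof
      fix k assume k: "k \<in> ?A n"
      then have "\<not> agree N (translate (int k) x) (translate (int k) y)"
        using N[of "translate (int k) x" "translate (int k) y"] by (auto simp: funpow_shift)
      then obtain i where "\<bar>i\<bar> \<le> int N" "x (i + int k) \<noteq> y (i + int k)"
        unfolding agree_def translate_def by blast
      then show "k \<in> (\<Union>i\<in>{- int N..int N}. ?U i)"
        using k by (intro UN_I[of i]) (auto simp: add.commute)
    qed
    then have "card (?A n) \<le> card (\<Union>i\<in>{- int N..int N}. ?U i)" by (intro card_mono) auto
    also have "\<dots> \<le> (\<Sum>i\<in>{- int N..int N}. card (?U i))" by (rule card_UN_le) simp
    also have "\<dots> \<le> (\<Sum>i\<in>{- int N..int N}. mismatch_count x y (- int N) (int n + int N))"
    proof (rule sum_mono)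
      fix i assume i: "i \<in> {- int N..int N}"
      have "card (?U i) = card ((\<lambda>k. int k + i) ` ?U i)"
        by (rule card_image[symmetric]) (auto simp: inj_on_def)
      also have "\<dots> \<le> mismatch_count x y (- int N) (int n + int N)"
        unfolding mismatch_count_def using i by (intro card_mono finite_mismatch_positions) auto
      finally show "card (?U i) \<le> mismatch_count x y (- int N) (int n + int N)" .
    qed
    also have "\<dots> = card {- int N..int N} * mismatch_count x y (- int N) (int n + int N)" by simp
    also have "card {- int N..int N} = 2 * N + 1" by simp
    finally have "real (card (?A n)) \<le> real ((2 * N + 1) * mismatch_count x y (- int N) (int n + int N))"
      by (simp only: of_nat_le_iff)
    then have "real (card (?A n)) \<le> ?N * real (mismatch_count x y (- int N) (int n + int N))"
      by (simp only: of_nat_mult)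
    also have "\<dots> \<le> ?N * (A * real n + B)" by (intro mult_left_mono M) auto
    finally show ?thesis .
  qed
  have "(\<lambda>n. ?N * A + ?N * B / real n) \<longlonglongrightarrow> ?N * A + 0"
    by (rule tendsto_add[OF tendsto_const lim_const_over_n])
  then have "(\<lambda>n. ereal (?N * A + ?N * B / real n)) \<longlonglongrightarrow> ereal (?N * A)" by simp
  then have "limsup (\<lambda>n. ereal (?N * A + ?N * B / real n)) = ereal (?N * A)"
    by (intro lim_imp_Limsup) auto
  moreover have "sep_density d \<delta> x y \<le> limsup (\<lambda>n. ereal (?N * A + ?N * B / real n))"
    unfolding sep_density_def
  proof (rule Limsup_mono)
    show "\<forall>\<^sub>F n in sequentially. ereal (real (card (?A n)) / real n) \<le> ereal (?N * A + ?N * B / real n)"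
      using eventually_gt_at_top[of 0]
    proof eventually_elim
      case (elim n)
      have "real (card (?A n)) / real n \<le> ?N * (A * real n + B) / real n"
        using le[of n] by (intro divide_right_mono) auto
      also have "\<dots> = ?N * A + ?N * B / real n" using elim by (simp add: field_simps)
      finally show ?case by simp
    qed
  qed
  ultimately show ?thesis by simp
qed

section \<open>Separation numbers\<close>

context block_fixed_point
begin

text \<open>
  A fixed point of \<open>S\<close> is one of every power of \<open>S\<close>; the upper bound uses all powers.
\<close>

lemma block_fixed_point_iterate: "block_fixed_point (Q ^ n) (block_iterate Q h n) x0 X"
proof
  have "(S ^^ n) x0 = x0" by (induction n) (simp_all add: fixed)
  then show "block_subst (Q ^ n) (block_iterate Q h n) x0 = x0"
    using funpow_block_subst[OF Q_pos] by metis
qed (use Q_pos X_eq minimal in auto)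

text \<open>
  Two points whose blocks start at the same places mismatch too rarely to be separated, so a
  separated set contains at most one point for each of the \<open>Q\<close> possible offsets.
\<close>

lemma separation_number_le_block_length:
  assumes N: "\<And>x y. agree N x y \<Longrightarrow> d x y < \<delta>"
    and \<nu>: "real (2 * N + 1) * (real (block_mismatches Q h) / real_of_int Q) < \<nu>"
  shows "separation_number d X \<delta> \<nu> \<le> enat (nat Q)"
  unfolding separation_number_def
proof (rule SUP_least)
  fix Y assume "Y \<in> {Y. Y \<subseteq> X \<and> (\<forall>x\<in>Y. \<forall>y\<in>Y. x \<noteq> y \<longrightarrow> sep_density d \<delta> x y \<ge> ereal \<nu>)}"
  then have Y: "Y \<subseteq> X" and sep: "\<And>x y. x \<in> Y \<Longrightarrow> y \<in> Y \<Longrightarrow> x \<noteq> y \<Longrightarrow> sep_density d \<delta> x y \<ge> ereal \<nu>"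
    by auto
  let ?D = "real (block_mismatches Q h)"
  obtain f g where fg: "\<And>x. x \<in> X \<Longrightarrow> f x \<in> {0..<Q} \<and> g x \<in> X \<and> x = translate (f x) (S (g x))"
    using translated_blocks_cover by metis
  have "inj_on f Y"
  proof (rule inj_onI, rule ccontr)
    fix x y assume xy: "x \<in> Y" "y \<in> Y" "f x = f y" "x \<noteq> y"
    let ?k = "f x"
    have x: "x = translate ?k (S (g x))" and y: "y = translate ?k (S (g y))"
      using fg xy Y by (metis subsetD)+
    have M: "real (mismatch_count x y (- int N) (int n + int N)) \<le> ?D / real_of_int Q * real n
      + ?D * (real (2 * N) / real_of_int Q + 2)" for n
    proof -
      have "mismatch_count x y (- int N) (int n + int N) =
        mismatch_count (S (g x)) (S (g y)) (- int N + ?k) (int n + int N + ?k)"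
        by (subst x, subst y) (rule mismatch_count_translate)
      also have "real \<dots> \<le> ?D * (real_of_int ((int n + int N + ?k) - (- int N + ?k)) / real_of_int Q + 2)"
        by (rule mismatch_count_block_subst_le[OF Q_pos]) simp
      also have "\<dots> = ?D / real_of_int Q * real n + ?D * (real (2 * N) / real_of_int Q + 2)"
        by (simp add: field_simps add_divide_distrib)
      finally show ?thesis .
    qed
    have "sep_density d \<delta> x y \<le> ereal (real (2 * N + 1) * (?D / real_of_int Q))"
      by (rule sep_density_le) (rule N M | assumption)+
    also have "\<dots> < ereal \<nu>" using \<nu> by simp
    finally show False using sep[OF xy(1,2,4)] by simp
  qed
  moreover have "f ` Y \<subseteq> {0..<Q}" using fg Y by blast
  ultimately have "finite Y" "card Y \<le> card {0..<Q}"
    using inj_on_finite[of f Y "{0..<Q}"] card_inj_on_le[of f Y "{0..<Q}"] by auto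
  then show "(if finite Y then enat (card Y) else \<infinity>) \<le> enat (nat Q)" by simp
qed

lemma separation_number_le:
  assumes "compatible_metric d" "\<delta> > 0"
  shows "\<exists>C>0. \<forall>n \<nu>. C * (real (block_mismatches Q h) / real_of_int Q) ^ n < \<nu> \<longrightarrow>
    separation_number d X \<delta> \<nu> \<le> enat (nat Q ^ n)"
proof -
  obtain N where N: "\<And>x y. agree N x y \<Longrightarrow> d x y < \<delta>"
    using compatible_metric_close_if_agree[OF assms] by blast
  have "separation_number d X \<delta> \<nu> \<le> enat (nat Q ^ n)"
    if "real (2 * N + 1) * (real (block_mismatches Q h) / real_of_int Q) ^ n < \<nu>" for n \<nu>
  proof -
    interpret I: block_fixed_point "Q ^ n" "block_iterate Q h n" x0 X by (rule block_fixed_point_iterate)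
    have "separation_number d X \<delta> \<nu> \<le> enat (nat (Q ^ n))"
      using that by (intro I.separation_number_le_block_length[OF N])
        (simp_all add: block_mismatches_iterate[OF Q_pos] power_divide)
    then show ?thesis using Q_pos by (simp add: nat_power_eq)
  qed
  then show ?thesis by (intro exI[of _ "real (2 * N + 1)"]) simp
qed

text \<open>
  The images \<open>S ` X\<close> with different offsets are disjoint and compact, so their points are told apart
  within a window of bounded size. Moving along both points by a multiple of \<open>Q\<close> does
  not change the offsets, so this happens in every window of that size.
\<close>

lemma different_offsets_bounded_gaps:
  assumes "infinite X"
  shows "\<exists>W>0. \<forall>u\<in>X. \<forall>v\<in>X. \<forall>k k'. 0 \<le> k \<longrightarrow> k < k' \<longrightarrow> k' < Q \<longrightarrow>
    (\<forall>a. \<exists>j\<in>{a..<a + int W}. translate k (S u) j \<noteq> translate k' (S v) j)"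
proof -
  have "\<exists>N. \<forall>x\<in>S ` X. \<forall>y\<in>translate r ` S ` X. \<not> agree N x y" if "r \<in> {0<..<Q}" for r
  proof (rule disjoint_compact_uniform_gap[OF compact_SX closedin_translate_image[OF closed_SX]])
    show "S ` X \<inter> translate r ` S ` X = {}" using block_offsets_unique[OF assms, of r] that by force
  qed
  then obtain f where f: "\<And>r x y. r \<in> {0<..<Q} \<Longrightarrow> x \<in> S ` X \<Longrightarrow> y \<in> translate r ` S ` X \<Longrightarrow> \<not> agree (f r) x y"
    by metis
  define N where "N = Max (insert 0 (f ` {0<..<Q}))"
  have N: "\<not> agree N (S u) (translate r (S v))" if "r \<in> {0<..<Q}" "u \<in> X" "v \<in> X" for r u v
  proof -
    have "f r \<le> N" unfolding N_def using that(1) by (intro Max_ge) auto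
    moreover have "\<not> agree (f r) (S u) (translate r (S v))" using f that by blast
    ultimately show ?thesis using agree_mono by blast
  qed
  have "\<exists>j\<in>{a..<a + int (2 * N + nat Q)}. translate k (S u) j \<noteq> translate k' (S v) j"
    if uv: "u \<in> X" "v \<in> X" and k: "0 \<le> k" "k < k'" "k' < Q" for u v k k' a
  proof -
    \<comment> \<open>\<open>Q * i\<close> is the least multiple of \<open>Q\<close> not below \<open>a + N + k\<close>\<close>
    define i where "i = (a + int N + k + Q - 1) div Q"
    have "Q * i + (a + int N + k + Q - 1) mod Q = a + int N + k + Q - 1" unfolding i_def by simp
    moreover have "0 \<le> (a + int N + k + Q - 1) mod Q" "(a + int N + k + Q - 1) mod Q < Q"
      using Q_pos by simp_all
    ultimately have i: "a + int N + k \<le> Q * i" "Q * i < a + int N + k + Q" by linarith+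
    have "k' - k \<in> {0<..<Q}" using k by auto
    then have "\<not> agree N (S (translate i u)) (translate (k' - k) (S (translate i v)))"
      by (rule N) (use uv translate_in_X in auto)
    then obtain m where m: "\<bar>m\<bar> \<le> int N"
      "S (translate i u) m \<noteq> translate (k' - k) (S (translate i v)) m" unfolding agree_def by blast
    define j where "j = m + Q * i - k"
    have "translate k (S u) j \<noteq> translate k' (S v) j"
      using m(2) unfolding S_translate j_def by (simp add: translate_def algebra_simps)
    moreover have "j \<in> {a..<a + int (2 * N + nat Q)}" using i m(1) Q_pos unfolding j_def by auto
    ultimately show ?thesis by blast
  qed
  then show ?thesis using Q_pos by (intro exI[of _ "2 * N + nat Q"]) auto
qed

text \<open>
  Induction on \<open>n\<close>, starting from a single point: a separated set \<open>Y\<close> yields the points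
  \<open>translate k (S y)\<close>. Those with different \<open>k\<close> mismatch with a density that depends only on the bounded
  gaps, those with equal \<open>k\<close> inherit the mismatches of \<open>Y\<close> at a density reduced by the factor
  \<open>block_mismatches Q h / Q\<close>. Each step multiplies the number of points by \<open>Q\<close>.
\<close>

lemma separated_sets:
  assumes "infinite X"
  shows "\<exists>c>0. \<forall>n. \<exists>Y\<subseteq>X. finite Y \<and> card Y = nat Q ^ n \<and>
    (\<forall>x\<in>Y. \<forall>y\<in>Y. x \<noteq> y \<longrightarrow> mismatch_density_ge (c * (real (block_mismatches Q h) / real_of_int Q) ^ n) x y)"
proof -
  let ?\<rho> = "real (block_mismatches Q h) / real_of_int Q"
  have "block_mismatches Q h \<le> nat Q" using Q_pos by (intro block_mismatches_le) simp
  then have rho: "0 < ?\<rho>" "?\<rho> \<le> 1" using mismatches_pos[OF assms] Q_pos by simp_all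
  obtain W where W: "W > 0" "\<And>u v k k' a. u \<in> X \<Longrightarrow> v \<in> X \<Longrightarrow> 0 \<le> k \<Longrightarrow> k < k' \<Longrightarrow> k' < Q \<Longrightarrow>
    \<exists>j\<in>{a..<a + int W}. translate k (S u) j \<noteq> translate k' (S v) j"
    using different_offsets_bounded_gaps[OF assms] by metis
  define c where "c = 1 / real W"
  have "c > 0" using W(1) by (simp add: c_def)
  have diff: "mismatch_density_ge c (translate k (S u)) (translate k' (S v))"
    if "u \<in> X" "v \<in> X" "k \<in> {0..<Q}" "k' \<in> {0..<Q}" "k \<noteq> k'" for u v k k'
  proof (cases "k < k'")
    case True
    then show ?thesis unfolding c_def using that
      by (intro mismatch_density_ge_if_bounded_gaps[OF W(1)] W(2)) auto
  next
    case False
    then have "k' < k" using that by simp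
    then have "\<exists>j\<in>{a..<a + int W}. translate k (S u) j \<noteq> translate k' (S v) j" for a
      using W(2)[of v u k' k a] that by (metis atLeastLessThan_iff)
    then show ?thesis unfolding c_def by (intro mismatch_density_ge_if_bounded_gaps[OF W(1)])
  qed
  have "\<exists>Y\<subseteq>X. finite Y \<and> card Y = nat Q ^ n \<and> (\<forall>x\<in>Y. \<forall>y\<in>Y. x \<noteq> y \<longrightarrow> mismatch_density_ge (c * ?\<rho> ^ n) x y)" for n
  proof (induction n)
    case 0
    show ?case using x0_in_X by (intro exI[of _ "{x0}"]) auto
  next
    case (Suc n)
    then obtain Y where Y: "Y \<subseteq> X" "finite Y" "card Y = nat Q ^ n"
      "\<And>x y. x \<in> Y \<Longrightarrow> y \<in> Y \<Longrightarrow> x \<noteq> y \<Longrightarrow> mismatch_density_ge (c * ?\<rho> ^ n) x y" by blast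
    let ?I = "{0..<Q} \<times> Y" and ?F = "\<lambda>(k, y). translate k (S y)"
    have "c * ?\<rho> ^ Suc n \<le> c * 1" using \<open>c > 0\<close> rho by (intro mult_left_mono power_le_one) auto
    then have cle: "c * ?\<rho> ^ Suc n \<le> c" by simp
    have sep: "mismatch_density_ge (c * ?\<rho> ^ Suc n) (?F p) (?F q)" if pq: "p \<in> ?I" "q \<in> ?I" "p \<noteq> q" for p q
    proof -
      obtain k u k' v where [simp]: "p = (k, u)" "q = (k', v)" by fastforce
      have mem: "k \<in> {0..<Q}" "k' \<in> {0..<Q}" "u \<in> Y" "v \<in> Y" using pq by auto
      show ?thesis
      proof (cases "k = k'")
        case True
        then have "mismatch_density_ge (c * ?\<rho> ^ n) u v" using pq mem Y(4) by auto
        then have "mismatch_density_ge (c * ?\<rho> ^ n * ?\<rho>) (S u) (S v)"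
          using \<open>c > 0\<close> rho by (intro mismatch_density_ge_block_subst Q_pos) auto
        then have "mismatch_density_ge (c * ?\<rho> ^ n * ?\<rho>) (translate k (S u)) (translate k (S v))"
          using mem by (intro mismatch_density_ge_translate) auto
        then show ?thesis using True by (simp add: mult_ac)
      next
        case False
        then have "mismatch_density_ge c (translate k (S u)) (translate k' (S v))"
          using mem Y(1) by (intro diff) auto
        then show ?thesis using mismatch_density_ge_mono[OF _ cle] by simp
      qed
    qed
    have pos: "c * ?\<rho> ^ Suc n > 0" using \<open>c > 0\<close> rho(1) by (intro mult_pos_pos zero_less_power)
    have "inj_on ?F ?I"
      by (rule inj_onI, rule ccontr) (use sep not_mismatch_density_ge_refl[OF pos] in metis)
    then have "card (?F ` ?I) = card ?I" by (rule card_image)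
    also have "\<dots> = nat Q ^ Suc n" by (simp only: card_cartesian_product Y(3)) simp
    finally have "card (?F ` ?I) = nat Q ^ Suc n" .
    moreover have "?F ` ?I \<subseteq> X" using Y(1) translate_in_X S_in_X by auto
    moreover have "finite (?F ` ?I)" using Y(2) by simp
    moreover have "\<forall>x\<in>?F ` ?I. \<forall>y\<in>?F ` ?I. x \<noteq> y \<longrightarrow> mismatch_density_ge (c * ?\<rho> ^ Suc n) x y"
    proof (intro ballI impI)
      fix x y assume "x \<in> ?F ` ?I" "y \<in> ?F ` ?I" "x \<noteq> y"
      then obtain p q where pq: "p \<in> ?I" "q \<in> ?I" "x = ?F p" "y = ?F q" by (elim imageE)
      then have "p \<noteq> q" using \<open>x \<noteq> y\<close> by blast
      then show "mismatch_density_ge (c * ?\<rho> ^ Suc n) x y" unfolding pq(3,4) by (rule sep[OF pq(1,2)])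
    qed
    ultimately show ?case by blast
  qed
  then show ?thesis using \<open>c > 0\<close> by blast
qed

lemma separation_number_ge:
  assumes "compatible_metric d" "infinite X"
  shows "\<exists>\<delta>>0. \<exists>c>0. \<forall>n \<nu>. \<nu> \<le> c * (real (block_mismatches Q h) / real_of_int Q) ^ n \<longrightarrow>
    enat (nat Q ^ n) \<le> separation_number d X \<delta> \<nu>"
proof -
  let ?\<rho> = "real (block_mismatches Q h) / real_of_int Q"
  obtain \<delta> where \<delta>: "\<delta> > 0" "\<And>x y. x 0 \<noteq> y 0 \<Longrightarrow> d x y \<ge> \<delta>"
    using compatible_metric_separates_letters[OF assms(1)] by blast
  obtain c where c: "c > 0" "\<And>n. \<exists>Y\<subseteq>X. finite Y \<and> card Y = nat Q ^ n \<and>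
      (\<forall>x\<in>Y. \<forall>y\<in>Y. x \<noteq> y \<longrightarrow> mismatch_density_ge (c * ?\<rho> ^ n) x y)"
    using separated_sets[OF assms(2)] by blast
  have "enat (nat Q ^ n) \<le> separation_number d X \<delta> \<nu>" if "\<nu> \<le> c * ?\<rho> ^ n" for n \<nu>
  proof -
    obtain Y where Y: "Y \<subseteq> X" "finite Y" "card Y = nat Q ^ n"
      "\<And>x y. x \<in> Y \<Longrightarrow> y \<in> Y \<Longrightarrow> x \<noteq> y \<Longrightarrow> mismatch_density_ge (c * ?\<rho> ^ n) x y" using c(2)[of n] by blast
    have "ereal \<nu> \<le> sep_density d \<delta> x y" if "x \<in> Y" "y \<in> Y" "x \<noteq> y" for x y
    proof -
      have "ereal (c * ?\<rho> ^ n) \<le> sep_density d \<delta> x y"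
        by (rule sep_density_ge[OF Y(4)[OF that]]) (rule \<delta>(2))
      moreover have "ereal \<nu> \<le> ereal (c * ?\<rho> ^ n)" using \<open>\<nu> \<le> c * ?\<rho> ^ n\<close> by simp
      ultimately show ?thesis by (rule order_trans[rotated])
    qed
    then show ?thesis
      unfolding separation_number_def using Y(1-3) by (intro SUP_upper2[of Y]) auto
  qed
  then show ?thesis using \<delta>(1) c(1) by blast
qed

end


section \<open>From separation numbers to amorphic complexity\<close>

lemma ln_enat_le:
  assumes "s \<le> enat k" "k > 0"
  shows "ln_enat s \<le> ereal (ln (real k))"
proof -
  obtain m where "s = enat m" "m \<le> k" using assms(1) by (cases s) auto
  then show ?thesis using assms(2) by (cases "m = 0") (auto simp: ln_enat_def)
qed

lemma ln_enat_ge: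
  assumes "enat k \<le> s" "k > 0"
  shows "ereal (ln (real k)) \<le> ln_enat s"
  using assms by (cases s) (auto simp: ln_enat_def)

lemma tendsto_const_minus_over_ln:
  "((\<lambda>\<nu>. ereal (A - B / ln \<nu>)) \<longlongrightarrow> ereal A) (at_right (0::real))"
proof -
  have "((\<lambda>\<nu>. B / ln \<nu>) \<longlongrightarrow> 0) (at_right (0::real))"
    by (rule tendsto_divide_0[OF tendsto_const filterlim_at_bot_imp_at_infinity[OF ln_at_0]])
  then have "((\<lambda>\<nu>. A - B / ln \<nu>) \<longlongrightarrow> A - 0) (at_right (0::real))"
    by (intro tendsto_diff tendsto_const)
  then show ?thesis by simp
qed

lemma eventually_at_right_0_less: "a > (0::real) \<Longrightarrow> eventually (\<lambda>\<nu>. 0 < \<nu> \<and> \<nu> < a) (at_right 0)"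
  using eventually_at_right_less[of "0::real"] eventually_at_rightI[of 0 a "\<lambda>\<nu>. 0 < \<nu> \<and> \<nu> < a"] by auto

text \<open>
  For given \<open>\<nu>\<close> the best \<open>n\<close> is about \<open>t = ln (C / \<nu>) / (- ln \<rho>)\<close>, and
  \<open>n \<le> t + 1\<close> bounds the quotient by \<open>ln q / (- ln \<rho>)\<close> plus a multiple of \<open>1 / ln \<nu>\<close>.
\<close>

lemma Limsup_growth_le:
  fixes s :: "real \<Rightarrow> enat" and q :: nat
  assumes q: "q > 0" and \<rho>: "0 < \<rho>" "\<rho> < 1" and C: "C > 0"
    and s: "\<And>n \<nu>. C * \<rho> ^ n < \<nu> \<Longrightarrow> s \<nu> \<le> enat (q ^ n)"
  shows "Limsup (at_right 0) (\<lambda>\<nu>. ln_enat (s \<nu>) / ereal (- ln \<nu>)) \<le> ereal (ln (real q) / (- ln \<rho>))"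
proof -
  define g where "g = - ln \<rho>"
  have g: "g > 0" using \<rho> by (simp add: g_def)
  define B where "B = ln (real q) * (ln C / g + 1)"
  have "eventually (\<lambda>\<nu>. 0 < \<nu> \<and> \<nu> < min 1 C) (at_right 0)"
    using C by (intro eventually_at_right_0_less) simp
  then have "eventually (\<lambda>\<nu>. ln_enat (s \<nu>) / ereal (- ln \<nu>) \<le> ereal (ln (real q) / g - B / ln \<nu>)) (at_right 0)"
  proof eventually_elim
    case (elim \<nu>)
    then have \<nu>: "0 < \<nu>" "ln \<nu> < 0" "ln \<nu> < ln C" using C by auto
    define t where "t = (ln C - ln \<nu>) / g"
    have "t > 0" using \<nu> g by (simp add: t_def)
    define n where "n = nat \<lfloor>t\<rfloor> + 1"
    have n: "t < real n" "real n \<le> t + 1" using \<open>t > 0\<close> unfolding n_def by linarith+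
    have "ln (C * \<rho> ^ n) = ln C - real n * g"
      using C \<rho> by (simp add: ln_mult ln_realpow g_def)
    also have "\<dots> < ln \<nu>" using n(1) g unfolding t_def by (simp add: field_simps)
    finally have "C * \<rho> ^ n < \<nu>" using \<nu>(1) C \<rho> by (simp add: ln_less_cancel_iff)
    then have "ln_enat (s \<nu>) \<le> ereal (ln (real (q ^ n)))" using s q by (intro ln_enat_le) auto
    also have "ln (real (q ^ n)) = real n * ln (real q)" using q by (simp add: ln_realpow)
    also have "ereal (real n * ln (real q)) \<le> ereal ((t + 1) * ln (real q))"
      using n(2) q by (simp add: mult_right_mono)
    finally have "ln_enat (s \<nu>) / ereal (- ln \<nu>) \<le> ereal ((t + 1) * ln (real q)) / ereal (- ln \<nu>)"
      using \<nu>(2) by (intro ereal_divide_right_mono) auto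
    also have "\<dots> = ereal (ln (real q) / g - B / ln \<nu>)"
      using \<nu>(2) g by (simp add: t_def B_def field_simps)
    finally show ?case .
  qed
  then have "Limsup (at_right 0) (\<lambda>\<nu>. ln_enat (s \<nu>) / ereal (- ln \<nu>))
      \<le> Limsup (at_right 0) (\<lambda>\<nu>. ereal (ln (real q) / g - B / ln \<nu>))"
    by (rule Limsup_mono)
  also have "\<dots> = ereal (ln (real q) / g)"
    by (intro lim_imp_Limsup tendsto_const_minus_over_ln) simp
  finally show ?thesis by (simp add: g_def)
qed

lemma Liminf_growth_ge:
  fixes s :: "real \<Rightarrow> enat" and q :: nat
  assumes q: "q > 0" and \<rho>: "0 < \<rho>" "\<rho> < 1" and C: "C > 0"
    and s: "\<And>n \<nu>. \<nu> \<le> C * \<rho> ^ n \<Longrightarrow> enat (q ^ n) \<le> s \<nu>"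
  shows "ereal (ln (real q) / (- ln \<rho>)) \<le> Liminf (at_right 0) (\<lambda>\<nu>. ln_enat (s \<nu>) / ereal (- ln \<nu>))"
proof -
  define g where "g = - ln \<rho>"
  have g: "g > 0" using \<rho> by (simp add: g_def)
  define B where "B = ln (real q) * (ln C / g - 1)"
  have "eventually (\<lambda>\<nu>. 0 < \<nu> \<and> \<nu> < min 1 C) (at_right 0)"
    using C by (intro eventually_at_right_0_less) simp
  then have "eventually (\<lambda>\<nu>. ereal (ln (real q) / g - B / ln \<nu>) \<le> ln_enat (s \<nu>) / ereal (- ln \<nu>)) (at_right 0)"
  proof eventually_elim
    case (elim \<nu>)
    then have \<nu>: "0 < \<nu>" "ln \<nu> < 0" "ln \<nu> < ln C" using C by auto
    define t where "t = (ln C - ln \<nu>) / g"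
    have "t > 0" using \<nu> g by (simp add: t_def)
    define n where "n = nat \<lfloor>t\<rfloor>"
    have n: "real n \<le> t" "t - 1 \<le> real n" using \<open>t > 0\<close> unfolding n_def by linarith+
    have "ln \<nu> \<le> ln C - real n * g" using n(1) g unfolding t_def by (simp add: field_simps)
    also have "\<dots> = ln (C * \<rho> ^ n)" 
      using C \<rho> by (simp add: ln_mult ln_realpow g_def)
    finally have "\<nu> \<le> C * \<rho> ^ n" using \<nu>(1) C \<rho> by (simp add: ln_le_cancel_iff)
    then have le: "ereal (ln (real (q ^ n))) \<le> ln_enat (s \<nu>)" using s q by (intro ln_enat_ge) auto
    have "ereal ((t - 1) * ln (real q)) \<le> ereal (real n * ln (real q))"
      using n(2) q by (simp add: mult_right_mono)
    also have "real n * ln (real q) = ln (real (q ^ n))" using q by (simp add: ln_realpow)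
    also note le
    finally have "ereal ((t - 1) * ln (real q)) / ereal (- ln \<nu>) \<le> ln_enat (s \<nu>) / ereal (- ln \<nu>)"
      using \<nu>(2) by (intro ereal_divide_right_mono) auto
    moreover have "ereal ((t - 1) * ln (real q)) / ereal (- ln \<nu>) = ereal (ln (real q) / g - B / ln \<nu>)"
      using \<nu>(2) g by (simp add: t_def B_def field_simps)
    ultimately show ?case by simp
  qed
  then have "Liminf (at_right 0) (\<lambda>\<nu>. ereal (ln (real q) / g - B / ln \<nu>))
      \<le> Liminf (at_right 0) (\<lambda>\<nu>. ln_enat (s \<nu>) / ereal (- ln \<nu>))"
    by (rule Liminf_mono)
  moreover have "Liminf (at_right 0) (\<lambda>\<nu>. ereal (ln (real q) / g - B / ln \<nu>)) = ereal (ln (real q) / g)"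
    by (intro lim_imp_Liminf tendsto_const_minus_over_ln) simp
  ultimately show ?thesis by (simp add: g_def)
qed

text \<open>
  The case of two blocks that differ everywhere: the separating density does not shrink with
  \<open>n\<close>, so the separation numbers are infinite for small \<open>\<nu>\<close>.
\<close>

lemma Liminf_growth_infinite:
  fixes s :: "real \<Rightarrow> enat" and q :: nat
  assumes q: "q \<ge> 2" and C: "C > 0"
    and s: "\<And>n \<nu>. \<nu> \<le> C \<Longrightarrow> enat (q ^ n) \<le> s \<nu>"
  shows "Liminf (at_right 0) (\<lambda>\<nu>. ln_enat (s \<nu>) / ereal (- ln \<nu>)) = \<infinity>"
proof -
  have inf: "s \<nu> = \<infinity>" if "\<nu> \<le> C" for \<nu>
  proof (cases "s \<nu>")
    case (enat m)
    have "m < 2 ^ m" by (rule less_exp)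
    also have "\<dots> \<le> q ^ m" using q by (intro power_mono) auto
    finally show ?thesis using s[OF that, of m] enat by simp
  qed
  have "eventually (\<lambda>\<nu>. 0 < \<nu> \<and> \<nu> < min 1 C) (at_right 0)"
    using C by (intro eventually_at_right_0_less) simp
  then have "eventually (\<lambda>\<nu>. \<infinity> \<le> ln_enat (s \<nu>) / ereal (- ln \<nu>)) (at_right 0)"
  proof eventually_elim
    case (elim \<nu>)
    then have "ln \<nu> < 0" "s \<nu> = \<infinity>" using inf by auto
    then show ?case by (simp add: ln_enat_def)
  qed
  then have "\<infinity> \<le> Liminf (at_right 0) (\<lambda>\<nu>. ln_enat (s \<nu>) / ereal (- ln \<nu>))"
    by (rule Liminf_bounded)
  then show ?thesis by simp
qed

lemma lower_le_upper_amorphic_complexity: "lower_amorphic_complexity d X \<le> upper_amorphic_complexity d X"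
  unfolding lower_amorphic_complexity_def upper_amorphic_complexity_def
  by (rule SUP_subset_mono[OF order_refl], rule Liminf_le_Limsup) simp

lemma (in block_fixed_point) amorphic_complexity:
  assumes d: "compatible_metric d" and inf: "infinite X" and Q: "Q \<ge> 2"
  shows "has_amorphic_complexity d X
    (if block_mismatches Q h = nat Q then \<infinity>
     else ereal (ln (real_of_int Q) / (ln (real_of_int Q) - ln (real (block_mismatches Q h)))))"
proof -
  let ?D = "block_mismatches Q h" and ?s = "separation_number d X"
  let ?\<rho> = "real ?D / real_of_int Q"
  obtain \<delta> c where \<delta>: "\<delta> > 0" "c > 0"
    and ge: "\<And>n \<nu>. \<nu> \<le> c * ?\<rho> ^ n \<Longrightarrow> enat (nat Q ^ n) \<le> ?s \<delta> \<nu>"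
    using separation_number_ge[OF d inf] by blast
  have lower: "Liminf (at_right 0) (\<lambda>\<nu>. ln_enat (?s \<delta> \<nu>) / ereal (- ln \<nu>)) \<le> lower_amorphic_complexity d X"
    unfolding lower_amorphic_complexity_def using \<delta>(1) by (intro SUP_upper) auto
  have le: "?D \<le> nat Q" using Q by (intro block_mismatches_le) simp
  show ?thesis
  proof (cases "?D = nat Q")
    case True
    then have "?\<rho> = 1" using Q by simp
    then have "Liminf (at_right 0) (\<lambda>\<nu>. ln_enat (?s \<delta> \<nu>) / ereal (- ln \<nu>)) = \<infinity>"
      using ge Q \<delta>(2) by (intro Liminf_growth_infinite[of "nat Q" c]) auto
    then have "lower_amorphic_complexity d X = \<infinity>" using lower by simp
    then have "upper_amorphic_complexity d X = \<infinity>"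
      using lower_le_upper_amorphic_complexity[of d X] by simp
    then show ?thesis using True \<open>lower_amorphic_complexity d X = \<infinity>\<close>
      by (simp add: has_amorphic_complexity_def)
  next
    case False
    then have "real ?D < real_of_int Q" using le Q by linarith
    then have \<rho>: "0 < ?\<rho>" "?\<rho> < 1" using mismatches_pos[OF inf] Q by simp_all
    let ?v = "ln (real (nat Q)) / (- ln ?\<rho>)"
    have "ereal ?v \<le> Liminf (at_right 0) (\<lambda>\<nu>. ln_enat (?s \<delta> \<nu>) / ereal (- ln \<nu>))"
      using Q by (intro Liminf_growth_ge[OF _ \<rho> \<delta>(2) ge]) auto
    then have "ereal ?v \<le> lower_amorphic_complexity d X" using lower by (rule order_trans)
    moreover have "upper_amorphic_complexity d X \<le> ereal ?v"
      unfolding upper_amorphic_complexity_def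
    proof (rule SUP_least)
      fix \<delta> :: real assume "\<delta> \<in> {0<..}"
      then obtain C where C: "C > 0" "\<And>n \<nu>. C * ?\<rho> ^ n < \<nu> \<Longrightarrow> ?s \<delta> \<nu> \<le> enat (nat Q ^ n)"
        using separation_number_le[OF d, of \<delta>] unfolding greaterThan_iff by blast
      show "Limsup (at_right 0) (\<lambda>\<nu>. ln_enat (?s \<delta> \<nu>) / ereal (- ln \<nu>)) \<le> ereal ?v"
        using Q by (intro Limsup_growth_le[OF _ \<rho> C]) auto
    qed
    moreover have v: "?v = ln (real_of_int Q) / (ln (real_of_int Q) - ln (real ?D))"
      using Q mismatches_pos[OF inf] by (simp add: ln_div)
    moreover note lower_le_upper_amorphic_complexity[of d X]
    ultimately have "lower_amorphic_complexity d X = ereal ?v" "upper_amorphic_complexity d X = ereal ?v"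
      by (meson antisym order_trans)+
    then show ?thesis using False v unfolding has_amorphic_complexity_def by simp
  qed
qed

section \<open>Constant length substitutions as block substitutions\<close>

lemma subst_biinf_eq_block_subst:
  assumes "constant_length \<theta> L" "L > 0"
  shows "subst_biinf \<theta> = block_subst (int L) (\<lambda>a j. \<theta> a ! nat j)"
proof (intro ext)
  fix x m
  have len: "length (\<theta> a) = L" for a using assms(1) by (simp add: constant_length_def)
  have "\<theta> a \<noteq> []" for a using len[of a] assms(2) by auto
  then have subst: "substitution \<theta>" by (simp add: substitution_def)
  have start: "block_start \<theta> x n = int L * n" for n
    by (cases "n \<ge> 0") (simp_all add: block_start_def len)
  have "nat (m mod int L) < L" using assms(2) by (simp add: nat_less_iff)
  moreover have "m = block_start \<theta> x (m div int L) + int (nat (m mod int L))"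
    using assms(2) by (simp add: start)
  ultimately show "subst_biinf \<theta> x m = block_subst (int L) (\<lambda>a j. \<theta> a ! nat j) x m"
    using subst_biinf_block[OF subst, of "nat (m mod int L)" x "m div int L"]
    by (simp add: len block_subst_def)
qed

lemma mismatches_eq_block_mismatches:
  "mismatches \<theta> L = block_mismatches (int L) (\<lambda>a j. \<theta> a ! nat j)"
proof -
  have "bij_betw int {j. j < L \<and> \<theta> 0 ! j \<noteq> \<theta> 1 ! j} {j\<in>{0..<int L}. \<theta> 0 ! nat j \<noteq> \<theta> 1 ! nat j}"
    by (rule bij_betwI[where g = nat]) auto
  then show ?thesis unfolding mismatches_def block_mismatches_def by (rule bij_betw_same_card)
qed

text \<open>
  With \<open>L = 1\<close> all iterated images of a letter would be single letters.
\<close>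

lemma primitive_imp_length_ge_2:
  fixes \<theta> :: "2 \<Rightarrow> 2 list"
  assumes "primitive \<theta>" "constant_length \<theta> L"
  shows "L \<ge> 2"
proof -
  have len: "length (\<theta> a) = L" for a using assms(2) by (simp add: constant_length_def)
  have word: "length (subst_word \<theta> w) = L * length w" for w
    by (induction w) (simp_all add: subst_word_def len)
  have pow: "length ((subst_word \<theta> ^^ n) [a]) = L ^ n" for n a
    by (induction n) (simp_all add: word)
  obtain l where l: "set ((subst_word \<theta> ^^ l) [0]) = (UNIV :: 2 set)"
    using assms(1) unfolding primitive_def by blast
  have "card (UNIV :: 2 set) = 2" by simp
  then have "2 \<le> L ^ l" using card_length[of "(subst_word \<theta> ^^ l) [0]"] l pow by metis
  moreover have "L ^ l \<le> 1 ^ l" if "L \<le> 1" using that by (intro power_mono) auto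
  ultimately show ?thesis by fastforce
qed

theorem theorem1p1:
  fixes \<theta> :: "2 \<Rightarrow> 2 list" and L :: nat and X :: "(int \<Rightarrow> 2) set"
    and d :: "(int \<Rightarrow> 2) \<Rightarrow> (int \<Rightarrow> 2) \<Rightarrow> real"
  assumes "substitution \<theta>"
    and "primitive \<theta>"
    and "constant_length \<theta> L"
    and "is_substitution_subshift \<theta> X"
    and "infinite X"
    and "compatible_metric d"
  shows "0 < mismatches \<theta> L \<and> mismatches \<theta> L \<le> L \<and>
    has_amorphic_complexity d X
      (if mismatches \<theta> L = L then \<infinity>
       else ereal (ln (real L) / (ln (real L) - ln (real (mismatches \<theta> L)))))"
proof -
  have L: "L \<ge> 2" using assms(2,3) by (rule primitive_imp_length_ge_2)
  define h where "h = (\<lambda>a j. \<theta> a ! nat j)"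
  define D where "D = mismatches \<theta> L"
  have D: "D = block_mismatches (int L) h" by (simp add: D_def h_def mismatches_eq_block_mismatches)
  obtain x0 p where p: "p > 0" "(subst_biinf \<theta> ^^ p) x0 = x0" "X = orbit_closure x0" "minimal_subshift X"
    using assms(4) unfolding is_substitution_subshift_def by blast
  have "(block_subst (int L) h ^^ p) x0 = x0"
    using p(2) L assms(3) by (simp add: subst_biinf_eq_block_subst h_def)
  then interpret block_fixed_point "int L ^ p" "block_iterate (int L) h p" x0 X
    using L p(3,4) by unfold_locales (simp_all add: funpow_block_subst)
  have Dp: "block_mismatches (int L ^ p) (block_iterate (int L) h p) = D ^ p"
    using L by (simp add: D block_mismatches_iterate)
  have Lp: "nat (int L ^ p) = L ^ p" by (simp add: nat_power_eq)
  have "D > 0" using mismatches_pos[OF assms(5)] p(1) unfolding Dp by simp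
  have "D \<le> L" unfolding D using block_mismatches_le[of "int L" h] by simp
  have "2 ^ 1 \<le> L ^ p" using L p(1) by (intro order_trans[OF power_increasing[of 1 p 2] power_mono]) auto
  then have "2 \<le> int L ^ p" by (metis of_nat_le_iff of_nat_numeral of_nat_power power_one_right)
  note ac = amorphic_complexity[OF assms(6,5) this]
  have eq_iff: "(D ^ p = L ^ p) = (D = L)" using p(1) by (simp add: power_eq_iff_eq_base)
  have quotient: "ln (real_of_int (int L ^ p)) / (ln (real_of_int (int L ^ p)) - ln (real (D ^ p))) =
      ln (real L) / (ln (real L) - ln (real D))"
  proof -
    have "ln (real_of_int (int L ^ p)) = real p * ln (real L)" using L by (simp add: ln_realpow)
    moreover have "ln (real (D ^ p)) = real p * ln (real D)" using \<open>D > 0\<close> by (simp add: ln_realpow)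
    ultimately show ?thesis using p(1) by (simp add: right_diff_distrib[symmetric])
  qed
  have "has_amorphic_complexity d X
      (if D = L then \<infinity> else ereal (ln (real L) / (ln (real L) - ln (real D))))"
    using ac unfolding Dp Lp eq_iff quotient .
  then show ?thesis using \<open>D > 0\<close> \<open>D \<le> L\<close> unfolding D_def by simp
qed

end
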